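(* Let $N\ge1$, let $\mathcal A$ be an alphabet of $2N$ symbols with distinguished symbols $\omega_1,\dots,\omega_N$, and let $\nu_1,\dots,\nu_N>0$ be given sizes of breaks. Each of the equalities $$(\Pi_{\alpha\beta}^{\mathrm{rb}})^{-1}=\mathcal I\,\Pi_{\beta\alpha}^{\mathrm{rb}}\,\mathcal I,\qquad (\Pi_{\alpha\beta}^{\mathrm{re}})^{-1}=\mathcal I\,\Pi_{\alpha\beta}^{\mathrm{lb}}\,\mathcal I,\qquad (\Pi_{\alpha\beta}^{\mathrm{lb}})^{-1}=\mathcal I\,\Pi_{\alpha\beta}^{\mathrm{re}}\,\mathcal I,\qquad (\Pi_{\alpha\beta}^{\mathrm{le}})^{-1}=\mathcal I\,\Pi_{\beta\alpha}^{\mathrm{le}}\,\mathcal I$$ ($\alpha,\beta\in\mathcal A$, $\alpha\neq\beta$) holds on the set of all those commuting collections for which the elementary induction steps in this equality are allowed for the corresponding rotational schemes of special type. Explicitly: let $(\Pi,\Pi^* )$ be one of the four pairs $(\Pi_{\alpha\beta}^{\mathrm{rb}},\Pi_{\beta\alpha}^{\mathrm{rb}})$, $(\Pi_{\alpha\beta}^{\mathrm{re}},\Pi_{\alpha\beta}^{\mathrm{lb}})$, $(\Pi_{\alpha\beta}^{\mathrm{lb}},\Pi_{\alpha\beta}^{\mathrm{re}})$, $(\Pi_{\alpha\beta}^{\mathrm{le}},\Pi_{\beta\alpha}^{\mathrm{le}})$. Let $\sigma$ be a rotational scheme of special type with stationary elements $\omega_1\mathrm b,\dots,\omega_N\mathrm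 b$, and let $\mathbf F=(F_\xi)_{\xi\in\mathcal A}$ be a commuting collection for $\sigma$ with sizes of breaks $\nu_1,\dots,\nu_N$. Suppose that $\Pi$ is allowed for $\sigma$ and that $\Pi^*$ is allowed for the scheme $\mathcal I\Pi\sigma$. Then $$\Pi^*\,\mathcal I\,\Pi\,\mathbf F=\mathcal I\,\mathbf F .$$
   Context: **Schemes.** Let $\bar{\mathcal A}=\mathcal A\times\{\mathrm b,\mathrm e\}$ (elements written $\alpha\mathrm b$, $\alpha\mathrm e$). An IRE scheme is a permutation $\sigma$ of $\bar{\mathcal A}$. It is *positive* if there is $\mathbf x\in\mathbb R^{\bar{\mathcal A}}$ with $x_{\sigma(\alpha\mathrm b)}-x_{\alpha\mathrm b}=x_{\alpha\mathrm e}-x_{\sigma(\alpha\mathrm e)}>0$ for all $\alpha\in\mathcal A$. An *interval exchange scheme* is a positive scheme each of whose cycles has the form $(\alpha_1\mathrm b,\dots,\alpha_m\mathrm b,\beta_n\mathrm e,\dots,\beta_1\mathrm e)$ with $m,n\ge1$ ($\sigma$ sends each entry to the next one, cyclically); such a cycle is written $\left[\begin{array}{ccc}\alpha_1&\dots&\alpha_m\\ \beta_1&\dots&\beta_n\end{array}\right]$. The *dual scheme* $\sigma^*=\mathcal I\sigma$ is $\sigma^*(\alpha\mathrm b)=\sigma(\alpha\mathrm e)$, $\sigma^*(\alpha\mathrm e)=\sigma(\alpha\mathrm b)$. An interval exchange scheme $\sigma$ is *rotational* if $\sigma^*$ is also an interval exchange scheme. With $|\mathcal A|=2N$ and distinguished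 distinct symbols $\omega_1,\dots,\omega_N\in\mathcal A$, the elements $\omega_i\mathrm b$ are called *stationary*; a rotational scheme $\sigma$ is *of special type* if $\sigma$ and $\sigma^*$ each consist of exactly $N$ cycles and every cycle of $\sigma$ and of $\sigma^*$ contains exactly one stationary element. Then $\sigma^*$ is also of special type, with the same stationary elements. **Linear-fractional functions.** $\mathrm{PSL}(2,\mathbb R)$ denotes the group of real $2\times2$ matrices with positive determinant modulo nonzero scalar matrices; the class of $\left(\begin{array}{cc}a&b\\c&d\end{array}\right)$ is identified with the algebraic increasing linear-fractional function $x\mapsto\frac{ax+b}{cx+d}$ (no domain is attached); composition $\circ$ is the group operation. $\mathrm{Id}$ is the identity function, and $\nu\,\mathrm{Id}$ is the function $x\mapsto\nu x$, i.e. the class of $\left(\begin{array}{cc}\nu&0\\0&1\end{array}\right)$. $F^{\intercal}$ is matrix transposition, which is well defined on $\mathrm{PSL}(2,\mathbb R)$. **Commuting collections.** Let $\sigma$ be a rotational scheme of special type, with $\sigma^*=\{z_1,\dots,z_N\}$, $\omega_i\mathrm b\in z_i$, $z_i=\left[\begin{array}{ccc}\gamma_{1i}&\dots&\gamma_{s_ii}\\ \delta_{1i}&\dots&\delta_{t_ii}\end{array}\right]$. Let $\nu_1,\dots,\nu_N>0$ ( *sizes of breaks* ). A collection $\mathbf F=(F_\alpha)_{\alpha\in\mathcal A}$ of elements of $\mathrm{PSL}(2,\mathbb R)$ is a *commuting collection* for $\sigma$ (and these stationary elements and sizes of breaks) if $$\tilde F_{\gamma_{s_ii}}\circ\dots\circ\tilde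 F_{\gamma_{1i}}=F_{\delta_{t_ii}}\circ\dots\circ F_{\delta_{1i}},\qquad 1\le i\le N,$$ where $\tilde F_{\omega_i}=F_{\omega_i}\circ\nu_i\mathrm{Id}$ and $\tilde F_\alpha=F_\alpha$ for $\alpha\notin\{\omega_1,\dots,\omega_N\}$. A commuting collection is understood together with its scheme; $\sigma$ is called the corresponding rotational scheme of special type. **Elementary induction steps** ($\alpha,\beta\in\mathcal A$, $\alpha\ne\beta$). Action on schemes, $\sigma'=\Pi\sigma$: - $\Pi_{\alpha\beta}^{\mathrm{rb}}$ is defined if $\sigma(\alpha\mathrm b)=\beta\mathrm e$. If $\sigma(\beta\mathrm e)=\alpha\mathrm e$ then $\sigma'=\sigma$; otherwise $\sigma'(\alpha\mathrm b)=\sigma(\beta\mathrm e)$, $\sigma'(\beta\mathrm e)=\alpha\mathrm e$, $\sigma'(\sigma^{-1}(\alpha\mathrm e))=\beta\mathrm e$, and $\sigma'=\sigma$ on all other elements. - $\Pi_{\alpha\beta}^{\mathrm{re}}$ is defined if $\sigma(\alpha\mathrm b)=\beta\mathrm e$. If $\sigma(\beta\mathrm b)=\alpha\mathrm b$ then $\sigma'=\sigma$; otherwise $\sigma'(\sigma^{-1}(\alpha\mathrm b))=\beta\mathrm e$, $\sigma'(\beta\mathrm b)=\alpha\mathrm b$, $\sigma'(\alpha\mathrm b)=\sigma(\beta\mathrm b)$, and $\sigma'=\sigma$ on all other elements. - $\Pi_{\alpha\beta}^{\mathrm{lb}}$ is defined if $\sigma(\beta\mathrm e)=\alpha\mathrm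 b$. If $\sigma(\alpha\mathrm e)=\beta\mathrm e$ then $\sigma'=\sigma$; otherwise $\sigma'(\sigma^{-1}(\beta\mathrm e))=\alpha\mathrm b$, $\sigma'(\alpha\mathrm e)=\beta\mathrm e$, $\sigma'(\beta\mathrm e)=\sigma(\alpha\mathrm e)$, and $\sigma'=\sigma$ on all other elements. - $\Pi_{\alpha\beta}^{\mathrm{le}}$ is defined if $\sigma(\beta\mathrm e)=\alpha\mathrm b$. If $\sigma(\alpha\mathrm b)=\beta\mathrm b$ then $\sigma'=\sigma$; otherwise $\sigma'(\beta\mathrm e)=\sigma(\alpha\mathrm b)$, $\sigma'(\alpha\mathrm b)=\beta\mathrm b$, $\sigma'(\sigma^{-1}(\beta\mathrm b))=\alpha\mathrm b$, and $\sigma'=\sigma$ on all other elements. Action on collections, $\mathbf F'=\Pi\mathbf F$: for $\Pi_{\alpha\beta}^{\mathrm{rb}}$ and $\Pi_{\alpha\beta}^{\mathrm{lb}}$, $F'_\beta=F_\alpha\circ F_\beta$ and $F'_\xi=F_\xi$ for $\xi\ne\beta$; for $\Pi_{\alpha\beta}^{\mathrm{re}}$ and $\Pi_{\alpha\beta}^{\mathrm{le}}$, $F'_\alpha=F_\alpha\circ F_\beta$ and $F'_\xi=F_\xi$ for $\xi\ne\alpha$. The scheme corresponding to $\Pi\mathbf F$ is $\Pi\sigma$. **Allowed steps.** The steps $\Pi_{\omega_i\beta}^{\mathrm{re}}$, $\Pi_{\omega_i\beta}^{\mathrm{lb}}$, $\Pi_{\alpha\omega_i}^{\mathrm{le}}$,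 $\Pi_{\omega_i\beta}^{\mathrm{le}}$ ($1\le i\le N$, $\alpha,\beta\in\mathcal A$) are *prohibited*. A step $\Pi$ is *ruining positiveness* for $\sigma$ if $\Pi\sigma$ is not positive. A step is *allowed* for a rotational scheme of special type $\sigma$ if it is defined on $\sigma$, not prohibited, and not ruining positiveness. An allowed step takes a rotational scheme of special type to a rotational scheme of special type with the same stationary elements, and a commuting collection for $\sigma$ to a commuting collection for $\Pi\sigma$ with the same sizes of breaks. **Nodal functions.** For each $\alpha\in\mathcal A$ take a rectangle $R_\alpha$ whose lower-left, lower-right, upper-right, upper-left corners are denoted $1\alpha,2\alpha,3\alpha,4\alpha$. The $8N$ corners are grouped into $4N$ pairs of *adjacent* corners (one pair for each element of $\bar{\mathcal A}$), determined by $\sigma$: for the element $\alpha\mathrm b$, the corner $1\alpha$ is adjacent to $4\beta$ if $\sigma^{-1}(\alpha\mathrm b)=\beta\mathrm e$, and to $2\beta$ if $\sigma^{-1}(\alpha\mathrm b)=\beta\mathrm b$; for the element $\alpha\mathrm e$, the corner $3\alpha$ is adjacent to $2\beta$ if $\sigma^{-1}(\alpha\mathrm e)=\beta\mathrm b$, and to $4\beta$ if $\sigma^{-1}(\alpha\mathrm e)=\beta\mathrm e$. For a commuting collection $\mathbf F$ for $\sigma$ there is a unique array $\mathbf\Phi=(\Phi_{p\alpha})_{1\le p\le4,\alpha\in\mathcal A}$ of elements of $\mathrm{PSL}(2,\mathbb R)$ ($\Phi_{p\alpha}$ is placed at the corner $p\alpha$) such that: 1) for every $1\le i\le N$, $\Phi_{1\omega_i}=\nu_i\mathrm{Id}$,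 and the function at the corner adjacent to $1\omega_i$ is $\mathrm{Id}$; 2) the functions at any two adjacent corners not covered by 1) are equal; 3) $\Phi_{4\alpha}=F_\alpha\circ\Phi_{1\alpha}$ and $\Phi_{3\alpha}=F_\alpha\circ\Phi_{2\alpha}$ for all $\alpha\in\mathcal A$. **Duality.** The dual array is $\Phi^*_{1\alpha}=\Phi_{1\alpha}^\intercal$, $\Phi^*_{2\alpha}=\Phi_{4\alpha}^\intercal$, $\Phi^*_{3\alpha}=\Phi_{3\alpha}^\intercal$, $\Phi^*_{4\alpha}=\Phi_{2\alpha}^\intercal$. The dual commuting collection $\mathbf F^*=\mathcal I\mathbf F=(F^*_\alpha)_{\alpha\in\mathcal A}$ is $F^*_\alpha=\Phi^*_{4\alpha}\circ(\Phi^*_{1\alpha})^{-1}=\Phi^*_{3\alpha}\circ(\Phi^*_{2\alpha})^{-1}$; it is a commuting collection for the scheme $\sigma^*$, with the same stationary elements and the same sizes of breaks, and $\mathcal I^2=\mathrm{Id}$. *)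

theory Defs
  imports "HOL-Analysis.Analysis" "HOL-Combinatorics.Orbits"
begin

section \<open>The group PSL(2,R)\<close>

definition psl_rel :: "real^2^2 \<Rightarrow> real^2^2 \<Rightarrow> bool" where
  "psl_rel A B \<longleftrightarrow> det A > 0 \<and> det B > 0 \<and> (\<exists>c. c \<noteq> 0 \<and> B = c *\<^sub>R A)"

lemma part_equivp_psl_rel: "part_equivp psl_rel"
proof (rule part_equivpI)
  have "psl_rel (mat 1) (mat 1)"
    unfolding psl_rel_def by (auto intro: exI[of _ 1])
  then show "\<exists>A. psl_rel A A" ..
  show "symp psl_rel"
  proof (rule sympI)
    fix A B assume "psl_rel A B"
    then obtain c where c: "det A > 0" "det B > 0" "c \<noteq> 0" "B = c *\<^sub>R A"
      unfolding psl_rel_def by blast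
    then have "A = inverse c *\<^sub>R B" by simp
    with c show "psl_rel B A"
      unfolding psl_rel_def by (metis nonzero_imp_inverse_nonzero)
  qed
  show "transp psl_rel"
  proof (rule transpI)
    fix A B C assume "psl_rel A B" "psl_rel B C"
    then show "psl_rel A C"
      unfolding psl_rel_def by (metis mult_eq_0_iff scaleR_scaleR)
  qed
qed

quotient_type psl = "real^2^2" / partial: psl_rel
  by (rule part_equivp_psl_rel)

text \<open>
  The class of a matrix with rows \<open>(a, b)\<close> and \<open>(c, d)\<close> stands for the linear-fractional
  function \<open>x \<mapsto> (a x + b) / (c x + d)\<close>; composition of functions is matrix multiplication.
\<close>

lift_definition psl_id :: psl is "mat 1"
  by (auto simp: psl_rel_def intro: exI[of _ 1])

lift_definition psl_comp :: "psl \<Rightarrow> psl \<Rightarrow> psl" (infixl \<open>\<odot>\<close> 70) is "(**)"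
proof -
  fix A B C D :: "real^2^2"
  assume "psl_rel A B" "psl_rel C D"
  then obtain c d where "c \<noteq> 0" "B = c *\<^sub>R A" "d \<noteq> 0" "D = d *\<^sub>R C"
    and det: "det A > 0" "det B > 0" "det C > 0" "det D > 0"
    unfolding psl_rel_def by blast
  then have "B ** D = (c * d) *\<^sub>R (A ** C)" "c * d \<noteq> 0"
    by (auto simp: vec_eq_iff matrix_matrix_mult_def sum_distrib_left intro!: sum.cong)
  with det show "psl_rel (A ** C) (B ** D)"
    unfolding psl_rel_def by (metis det_mul mult_pos_pos)
qed

lift_definition psl_inv :: "psl \<Rightarrow> psl" is matrix_inv
proof -
  fix A B :: "real^2^2"
  assume "psl_rel A B"
  then obtain c where c: "c \<noteq> 0" "B = c *\<^sub>R A" and det: "det A > 0" "det B > 0"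
    unfolding psl_rel_def by blast
  have inv: "M ** matrix_inv M = mat 1" "matrix_inv M ** M = mat 1"
    if "det M > 0" for M :: "real^2^2"
  proof -
    from that have "invertible M" by (simp add: invertible_det_nz)
    then show "M ** matrix_inv M = mat 1" "matrix_inv M ** M = mat 1"
      unfolding matrix_inv_def invertible_def by (metis (mono_tags, lifting) someI)+
  qed
  have pos: "det (matrix_inv M) > 0" if "det M > 0" for M :: "real^2^2"
  proof -
    have "det M * det (matrix_inv M) = 1"
      using inv(1)[OF that] by (metis det_I det_mul)
    with that show ?thesis by (metis zero_less_mult_pos zero_less_one)
  qed
  have "A ** (c *\<^sub>R matrix_inv B) = B ** matrix_inv B"
    using c by (simp add: vec_eq_iff matrix_matrix_mult_def sum_distrib_left algebra_simps)
  then have "A ** (c *\<^sub>R matrix_inv B) = mat 1"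
    using inv(1)[OF det(2)] by simp
  then have "matrix_inv A = c *\<^sub>R matrix_inv B"
    using inv(2)[OF det(1)] by (metis matrix_mul_assoc matrix_mul_lid matrix_mul_rid)
  then have "matrix_inv B = inverse c *\<^sub>R matrix_inv A"
    using c(1) by simp
  then show "psl_rel (matrix_inv A) (matrix_inv B)"
    unfolding psl_rel_def using pos det c(1) by (metis nonzero_imp_inverse_nonzero)
qed

lift_definition psl_transpose :: "psl \<Rightarrow> psl" is transpose
  by (auto simp: psl_rel_def det_2 transpose_def vec_eq_iff algebra_simps)

text \<open>The function \<open>x \<mapsto> \<nu> x\<close>; meaningful only for \<open>\<nu> > 0\<close>.\<close>

definition psl_scale :: "real \<Rightarrow> psl" where
  "psl_scale \<nu> = abs_psl (vector [vector [\<nu>, 0], vector [0, 1]])"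

section \<open>Schemes\<close>

datatype side = Beg | End

type_synonym 'a scheme = "'a \<times> side \<Rightarrow> 'a \<times> side"

definition positive :: "'a scheme \<Rightarrow> bool" where
  "positive \<sigma> \<longleftrightarrow> (\<exists>x :: 'a \<times> side \<Rightarrow> real. \<forall>\<alpha>.
     x (\<sigma> (\<alpha>, Beg)) - x (\<alpha>, Beg) = x (\<alpha>, End) - x (\<sigma> (\<alpha>, End)) \<and>
     x (\<sigma> (\<alpha>, Beg)) - x (\<alpha>, Beg) > 0)"

text \<open>
  The entries of the cycle with top row \<open>\<alpha>s\<close> and bottom row \<open>\<beta>s\<close>, in the order in which the
  permutation runs through them; the bottom row is traversed from right to left.
\<close>

definition cycle_list :: "'a list \<Rightarrow> 'a list \<Rightarrow> ('a \<times> side) list" where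
  "cycle_list \<alpha>s \<beta>s = map (\<lambda>\<alpha>. (\<alpha>, Beg)) \<alpha>s @ map (\<lambda>\<beta>. (\<beta>, End)) (rev \<beta>s)"

definition has_cycle :: "'a scheme \<Rightarrow> 'a list \<Rightarrow> 'a list \<Rightarrow> bool" where
  "has_cycle \<sigma> \<alpha>s \<beta>s \<longleftrightarrow> \<alpha>s \<noteq> [] \<and> \<beta>s \<noteq> [] \<and>
     (let c = cycle_list \<alpha>s \<beta>s in
        distinct c \<and> (\<forall>k < length c. \<sigma> (c ! k) = c ! (Suc k mod length c)))"

definition interval_exchange_scheme :: "'a scheme \<Rightarrow> bool" where
  "interval_exchange_scheme \<sigma> \<longleftrightarrow> bij \<sigma> \<and> positive \<sigma> \<and>
     (\<forall>x. \<exists>\<alpha>s \<beta>s. has_cycle \<sigma> \<alpha>s \<beta>s \<and> x \<in> set (cycle_list \<alpha>s \<beta>s))"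

fun flip :: "'a \<times> side \<Rightarrow> 'a \<times> side" where
  "flip (\<alpha>, Beg) = (\<alpha>, End)"
| "flip (\<alpha>, End) = (\<alpha>, Beg)"

definition dual_scheme :: "'a scheme \<Rightarrow> 'a scheme" where
  "dual_scheme \<sigma> = (\<lambda>x. \<sigma> (flip x))"

definition rotational :: "'a scheme \<Rightarrow> bool" where
  "rotational \<sigma> \<longleftrightarrow> interval_exchange_scheme \<sigma> \<and> interval_exchange_scheme (dual_scheme \<sigma>)"

definition cycles :: "'a scheme \<Rightarrow> ('a \<times> side) set set" where
  "cycles \<sigma> = range (orbit \<sigma>)"

definition stationary :: "nat \<Rightarrow> (nat \<Rightarrow> 'a) \<Rightarrow> ('a \<times> side) set" where
  "stationary N \<omega> = {(\<omega> i, Beg) | i. i \<in> {1..N}}"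

definition special_type :: "nat \<Rightarrow> (nat \<Rightarrow> 'a) \<Rightarrow> 'a scheme \<Rightarrow> bool" where
  "special_type N \<omega> \<sigma> \<longleftrightarrow> rotational \<sigma> \<and>
     (\<forall>\<tau> \<in> {\<sigma>, dual_scheme \<sigma>}.
        card (cycles \<tau>) = N \<and> (\<forall>c \<in> cycles \<tau>. \<exists>!x. x \<in> c \<and> x \<in> stationary N \<omega>))"

section \<open>Commuting collections\<close>

text \<open>A collection is kept together with its scheme.\<close>

type_synonym 'a collection = "'a scheme \<times> ('a \<Rightarrow> psl)"

definition with_breaks ::
  "nat \<Rightarrow> (nat \<Rightarrow> 'a) \<Rightarrow> (nat \<Rightarrow> real) \<Rightarrow> ('a \<Rightarrow> psl) \<Rightarrow> 'a \<Rightarrow> psl" where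
  "with_breaks N \<omega> \<nu> F \<alpha> =
     (if \<alpha> \<in> \<omega> ` {1..N} then F \<alpha> \<odot> psl_scale (\<nu> (inv_into {1..N} \<omega> \<alpha>)) else F \<alpha>)"

text \<open>\<open>comp_along F [\<gamma>\<^sub>1, \<dots>, \<gamma>\<^sub>s] = F \<gamma>\<^sub>s \<odot> \<dots> \<odot> F \<gamma>\<^sub>1\<close>\<close>

definition comp_along :: "('a \<Rightarrow> psl) \<Rightarrow> 'a list \<Rightarrow> psl" where
  "comp_along F \<gamma>s = fold (\<lambda>\<gamma> G. F \<gamma> \<odot> G) \<gamma>s psl_id"

fun commuting_collection ::
  "nat \<Rightarrow> (nat \<Rightarrow> 'a) \<Rightarrow> (nat \<Rightarrow> real) \<Rightarrow> 'a collection \<Rightarrow> bool" where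
  "commuting_collection N \<omega> \<nu> (\<sigma>, F) \<longleftrightarrow>
     (\<forall>i \<in> {1..N}. \<forall>\<gamma>s \<delta>s. has_cycle (dual_scheme \<sigma>) \<gamma>s \<delta>s \<and> \<omega> i \<in> set \<gamma>s \<longrightarrow>
        comp_along (with_breaks N \<omega> \<nu> F) \<gamma>s = comp_along F \<delta>s)"

section \<open>Elementary induction steps\<close>

text \<open>
  \<open>RB \<alpha> \<beta>\<close>, \<open>RE \<alpha> \<beta>\<close>, \<open>LB \<alpha> \<beta>\<close>, \<open>LE \<alpha> \<beta>\<close> are the steps with superscripts rb, re, lb, le and
  subscript \<open>\<alpha>\<beta>\<close>. They are considered for \<open>\<alpha> \<noteq> \<beta>\<close> only, and their action is meaningful
  only where \<open>step_defined\<close> holds.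
\<close>

datatype 'a step = RB 'a 'a | RE 'a 'a | LB 'a 'a | LE 'a 'a

fun step_defined :: "'a step \<Rightarrow> 'a scheme \<Rightarrow> bool" where
  "step_defined (RB \<alpha> \<beta>) \<sigma> \<longleftrightarrow> \<sigma> (\<alpha>, Beg) = (\<beta>, End)"
| "step_defined (RE \<alpha> \<beta>) \<sigma> \<longleftrightarrow> \<sigma> (\<alpha>, Beg) = (\<beta>, End)"
| "step_defined (LB \<alpha> \<beta>) \<sigma> \<longleftrightarrow> \<sigma> (\<beta>, End) = (\<alpha>, Beg)"
| "step_defined (LE \<alpha> \<beta>) \<sigma> \<longleftrightarrow> \<sigma> (\<beta>, End) = (\<alpha>, Beg)"

fun step_scheme :: "'a step \<Rightarrow> 'a scheme \<Rightarrow> 'a scheme" where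
  "step_scheme (RB \<alpha> \<beta>) \<sigma> =
     (if \<sigma> (\<beta>, End) = (\<alpha>, End) then \<sigma>
      else \<sigma>((\<alpha>, Beg) := \<sigma> (\<beta>, End), (\<beta>, End) := (\<alpha>, End), inv \<sigma> (\<alpha>, End) := (\<beta>, End)))"
| "step_scheme (RE \<alpha> \<beta>) \<sigma> =
     (if \<sigma> (\<beta>, Beg) = (\<alpha>, Beg) then \<sigma>
      else \<sigma>(inv \<sigma> (\<alpha>, Beg) := (\<beta>, End), (\<beta>, Beg) := (\<alpha>, Beg), (\<alpha>, Beg) := \<sigma> (\<beta>, Beg)))"
| "step_scheme (LB \<alpha> \<beta>) \<sigma> =
     (if \<sigma> (\<alpha>, End) = (\<beta>, End) then \<sigma>
      else \<sigma>(inv \<sigma> (\<beta>, End) := (\<alpha>, Beg), (\<alpha>, End) := (\<beta>, End), (\<beta>, End) := \<sigma> (\<alpha>, End)))"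
| "step_scheme (LE \<alpha> \<beta>) \<sigma> =
     (if \<sigma> (\<alpha>, Beg) = (\<beta>, Beg) then \<sigma>
      else \<sigma>((\<beta>, End) := \<sigma> (\<alpha>, Beg), (\<alpha>, Beg) := (\<beta>, Beg), inv \<sigma> (\<beta>, Beg) := (\<alpha>, Beg)))"

fun step_functions :: "'a step \<Rightarrow> ('a \<Rightarrow> psl) \<Rightarrow> 'a \<Rightarrow> psl" where
  "step_functions (RB \<alpha> \<beta>) F = F(\<beta> := F \<alpha> \<odot> F \<beta>)"
| "step_functions (RE \<alpha> \<beta>) F = F(\<alpha> := F \<alpha> \<odot> F \<beta>)"
| "step_functions (LB \<alpha> \<beta>) F = F(\<beta> := F \<alpha> \<odot> F \<beta>)"
| "step_functions (LE \<alpha> \<beta>) F = F(\<alpha> := F \<alpha> \<odot> F \<beta>)"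

fun step_collection :: "'a step \<Rightarrow> 'a collection \<Rightarrow> 'a collection" where
  "step_collection p (\<sigma>, F) = (step_scheme p \<sigma>, step_functions p F)"

fun prohibited :: "nat \<Rightarrow> (nat \<Rightarrow> 'a) \<Rightarrow> 'a step \<Rightarrow> bool" where
  "prohibited N \<omega> (RB \<alpha> \<beta>) \<longleftrightarrow> False"
| "prohibited N \<omega> (RE \<alpha> \<beta>) \<longleftrightarrow> \<alpha> \<in> \<omega> ` {1..N}"
| "prohibited N \<omega> (LB \<alpha> \<beta>) \<longleftrightarrow> \<alpha> \<in> \<omega> ` {1..N}"
| "prohibited N \<omega> (LE \<alpha> \<beta>) \<longleftrightarrow> \<alpha> \<in> \<omega> ` {1..N} \<or> \<beta> \<in> \<omega> ` {1..N}"

definition allowed :: "nat \<Rightarrow> (nat \<Rightarrow> 'a) \<Rightarrow> 'a step \<Rightarrow> 'a scheme \<Rightarrow> bool" where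
  "allowed N \<omega> p \<sigma> \<longleftrightarrow>
     step_defined p \<sigma> \<and> \<not> prohibited N \<omega> p \<and> positive (step_scheme p \<sigma>)"

section \<open>Nodal functions and duality\<close>

text \<open>The corners are, in this order, lower-left, lower-right, upper-right, upper-left.\<close>

datatype corner = C1 | C2 | C3 | C4

text \<open>
  The pairs of adjacent corners are indexed by the elements of the doubled alphabet: the pair of
  \<open>x\<close> consists of \<open>own_corner x\<close> and \<open>adjacent_corner \<sigma> x\<close>.
\<close>

fun own_corner :: "'a \<times> side \<Rightarrow> corner \<times> 'a" where
  "own_corner (\<alpha>, Beg) = (C1, \<alpha>)"
| "own_corner (\<alpha>, End) = (C3, \<alpha>)"

definition adjacent_corner :: "'a scheme \<Rightarrow> 'a \<times> side \<Rightarrow> corner \<times> 'a" where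
  "adjacent_corner \<sigma> x =
     (case inv \<sigma> x of (\<beta>, Beg) \<Rightarrow> (C2, \<beta>) | (\<beta>, End) \<Rightarrow> (C4, \<beta>))"

fun nodal_functions ::
  "nat \<Rightarrow> (nat \<Rightarrow> 'a) \<Rightarrow> (nat \<Rightarrow> real) \<Rightarrow> 'a collection \<Rightarrow> (corner \<times> 'a \<Rightarrow> psl) \<Rightarrow> bool" where
  "nodal_functions N \<omega> \<nu> (\<sigma>, F) \<Phi> \<longleftrightarrow>
     (\<forall>i \<in> {1..N}. \<Phi> (C1, \<omega> i) = psl_scale (\<nu> i) \<and>
                   \<Phi> (adjacent_corner \<sigma> (\<omega> i, Beg)) = psl_id) \<and>
     (\<forall>x. x \<notin> stationary N \<omega> \<longrightarrow> \<Phi> (own_corner x) = \<Phi> (adjacent_corner \<sigma> x)) \<and>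
     (\<forall>\<alpha>. \<Phi> (C4, \<alpha>) = F \<alpha> \<odot> \<Phi> (C1, \<alpha>) \<and> \<Phi> (C3, \<alpha>) = F \<alpha> \<odot> \<Phi> (C2, \<alpha>))"

definition nodal_array ::
  "nat \<Rightarrow> (nat \<Rightarrow> 'a) \<Rightarrow> (nat \<Rightarrow> real) \<Rightarrow> 'a collection \<Rightarrow> corner \<times> 'a \<Rightarrow> psl" where
  "nodal_array N \<omega> \<nu> c = (THE \<Phi>. nodal_functions N \<omega> \<nu> c \<Phi>)"

fun dual_array :: "(corner \<times> 'a \<Rightarrow> psl) \<Rightarrow> corner \<times> 'a \<Rightarrow> psl" where
  "dual_array \<Phi> (C1, \<alpha>) = psl_transpose (\<Phi> (C1, \<alpha>))"
| "dual_array \<Phi> (C2, \<alpha>) = psl_transpose (\<Phi> (C4, \<alpha>))"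
| "dual_array \<Phi> (C3, \<alpha>) = psl_transpose (\<Phi> (C3, \<alpha>))"
| "dual_array \<Phi> (C4, \<alpha>) = psl_transpose (\<Phi> (C2, \<alpha>))"

definition dual_collection ::
  "nat \<Rightarrow> (nat \<Rightarrow> 'a) \<Rightarrow> (nat \<Rightarrow> real) \<Rightarrow> 'a collection \<Rightarrow> 'a collection" where
  "dual_collection N \<omega> \<nu> c =
     (let \<Psi> = dual_array (nodal_array N \<omega> \<nu> c)
      in (dual_scheme (fst c), \<lambda>\<alpha>. \<Psi> (C4, \<alpha>) \<odot> psl_inv (\<Psi> (C1, \<alpha>))))"

end

theory Submission
  imports Defs
begin

text \<open>
  Everything takes place in one nodal array. With \<open>\<Phi>\<close> the nodal array of \<open>(\<sigma>, F)\<close>, the dual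
  functions are \<open>F\<^sup>*\<^sub>\<alpha> = (\<Phi>\<^sub>1\<^sub>\<alpha>\<inverse> \<odot> \<Phi>\<^sub>2\<^sub>\<alpha>)\<^sup>T\<close> (\<open>dual_collection_eq\<close>): while \<open>F\<^sub>\<alpha>\<close> transports from the
  bottom of the rectangle \<open>R\<^sub>\<alpha>\<close> to its top, \<open>F\<^sup>*\<^sub>\<alpha>\<close> records the change along its bottom side.
  An elementary step cuts one of two adjacent rectangles and stacks or juxtaposes the piece with
  the other one; the function at a corner that stays where it was does not change, and only four
  corners move. So the array of the new collection is \<open>\<Phi>\<close> with four explicit changes
  (\<open>step_nodal\<close>, \<open>nodal_functions_step\<close>). Just one dual function changes then, and the dual
  step multiplies the very same one by another dual function. That the product is the old
  value is a cancellation between one pair of adjacent corners and one side of a rectangle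
  (\<open>dual_steps_functions\<close>). On schemes, unless nothing changes, the step and its dual exchange
  the images of three elements cyclically, and the two 3-cycles are inverse to each other (\<open>dual_steps_scheme\<close>).

  For this computation the array must be known to exist and to be unique, since \<open>dual_collection\<close>
  takes it as a definite description. Walking from a corner along a vertical side and then
  across an adjacency replaces \<open>x\<close> by \<open>\<sigma>\<^sup>* x\<close>; hence the array is a solution of a transport problem
  along the cycles of \<open>\<sigma>\<^sup>*\<close> with prescribed values at the stationary elements. It has at most
  one solution as soon as every cycle of \<open>\<sigma>\<^sup>*\<close> contains a stationary element
  (\<open>nodal_functions_unique\<close>). It has one if moreover that element is unique and the holonomy
  around each cycle is trivial; the latter is precisely the commuting relation
  (\<open>nodal_functions_exist\<close>). After the step, existence comes for free from the
  explicit array, and uniqueness because the step changes the cycles of \<open>\<sigma>\<^sup>*\<close> only by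
  moving a single nonstationary element to another place
  (\<open>step_scheme_bij_meets_dual_orbits\<close>). This is where the prohibited steps matter, besides the
  gluing of corners at stationary elements, across which the array jumps.
\<close>

section \<open>The group laws of linear-fractional functions\<close>

lemma psl_comp_assoc: "(A \<odot> B) \<odot> C = A \<odot> (B \<odot> C)"
  by transfer (auto simp: psl_rel_def matrix_mul_assoc det_mul intro!: exI[of _ 1])

lemma matrix_inv_inverse:
  fixes M :: "real^2^2"
  assumes "det M > 0"
  shows "M ** matrix_inv M = mat 1" "matrix_inv M ** M = mat 1"
proof -
  have "invertible M"
    using assms by (simp add: invertible_det_nz)
  then show "M ** matrix_inv M = mat 1" "matrix_inv M ** M = mat 1"
    unfolding matrix_inv_def invertible_def by (metis (mono_tags, lifting) someI)+
qed

lemma psl_comp_id_left: "psl_id \<odot> A = A"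
  by transfer (auto simp: psl_rel_def intro!: exI[of _ 1])

lemma psl_inv_left: "psl_inv A \<odot> A = psl_id"
  by transfer (auto simp: psl_rel_def matrix_inv_inverse intro!: exI[of _ 1])

interpretation psl: group psl_comp psl_id psl_inv
  by unfold_locales (rule psl_comp_assoc psl_comp_id_left psl_inv_left)+

lemma psl_inv_cancel_left [simp]: "psl_inv A \<odot> (A \<odot> B) = B" "A \<odot> (psl_inv A \<odot> B) = B"
  by (simp_all flip: psl.assoc)

lemma psl_transpose_comp: "psl_transpose (A \<odot> B) = psl_transpose B \<odot> psl_transpose A"
  by transfer (auto simp: psl_rel_def matrix_transpose_mul det_mul det_transpose intro!: exI[of _ 1])

lemma psl_transpose_id: "psl_transpose psl_id = psl_id"
  by transfer (auto simp: psl_rel_def intro!: exI[of _ 1])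

lemma psl_transpose_inv: "psl_transpose (psl_inv A) = psl_inv (psl_transpose A)"
proof -
  have "psl_transpose (psl_inv A) \<odot> psl_transpose A = psl_id"
    by (simp add: psl_transpose_id flip: psl_transpose_comp)
  then show ?thesis
    by (metis psl.inverse_unique psl.inverse_inverse)
qed

section \<open>Uniqueness of the nodal array\<close>

text \<open>
  Every element \<open>x\<close> labels two corners: its own one, and the one whose adjacent corner is the
  own corner of \<open>\<sigma> x\<close>. In this form adjacency involves \<open>\<sigma>\<close> instead of its inverse, and the
  updates of \<open>\<sigma>\<close> made by a step can be read off directly.
\<close>

fun exit_corner :: "'a \<times> side \<Rightarrow> corner \<times> 'a" where
  "exit_corner (\<alpha>, Beg) = (C2, \<alpha>)"
| "exit_corner (\<alpha>, End) = (C4, \<alpha>)"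

lemma adjacent_corner_apply: "inj \<sigma> \<Longrightarrow> adjacent_corner \<sigma> (\<sigma> x) = exit_corner x"
  by (cases x rule: exit_corner.cases) (simp_all add: adjacent_corner_def)

lemma nodal_functions_iff:
  assumes "bij \<sigma>"
  shows "nodal_functions N \<omega> \<nu> (\<sigma>, F) \<Phi> \<longleftrightarrow>
     (\<forall>i \<in> {1..N}. \<Phi> (C1, \<omega> i) = psl_scale (\<nu> i)) \<and>
     (\<forall>x. \<Phi> (exit_corner x) =
        (if \<sigma> x \<in> stationary N \<omega> then psl_id else \<Phi> (own_corner (\<sigma> x)))) \<and>
     (\<forall>\<alpha>. \<Phi> (C4, \<alpha>) = F \<alpha> \<odot> \<Phi> (C1, \<alpha>) \<and> \<Phi> (C3, \<alpha>) = F \<alpha> \<odot> \<Phi> (C2, \<alpha>))"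
proof -
  have adj: "adjacent_corner \<sigma> (\<sigma> x) = exit_corner x" for x
    using adjacent_corner_apply assms bij_is_inj by blast
  have "(\<forall>i \<in> {1..N}. \<Phi> (adjacent_corner \<sigma> (\<omega> i, Beg)) = psl_id) \<longleftrightarrow>
        (\<forall>y. y \<in> stationary N \<omega> \<longrightarrow> \<Phi> (adjacent_corner \<sigma> y) = psl_id)"
    unfolding stationary_def by blast
  also have "\<dots> \<longleftrightarrow> (\<forall>x. \<sigma> x \<in> stationary N \<omega> \<longrightarrow> \<Phi> (exit_corner x) = psl_id)"
    using assms adj by (metis bij_pointE)
  finally have 1: "(\<forall>i \<in> {1..N}. \<Phi> (adjacent_corner \<sigma> (\<omega> i, Beg)) = psl_id) \<longleftrightarrow>
      (\<forall>x. \<sigma> x \<in> stationary N \<omega> \<longrightarrow> \<Phi> (exit_corner x) = psl_id)" .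
  have 2: "(\<forall>y. y \<notin> stationary N \<omega> \<longrightarrow> \<Phi> (own_corner y) = \<Phi> (adjacent_corner \<sigma> y)) \<longleftrightarrow>
      (\<forall>x. \<sigma> x \<notin> stationary N \<omega> \<longrightarrow> \<Phi> (own_corner (\<sigma> x)) = \<Phi> (exit_corner x))"
    using assms adj by (metis bij_pointE)
  show ?thesis
    unfolding nodal_functions.simps ball_conj_distrib 1 2 by auto
qed

text \<open>
  For a permutation this says that every orbit meets \<open>S\<close>. Stated with invariant
  sets it is immediately applicable to the set on which two arrays agree, and it can be
  transferred to a modified permutation without speaking about orbits.
\<close>

definition meets_all_orbits :: "'b set \<Rightarrow> ('b \<Rightarrow> 'b) \<Rightarrow> bool" where
  "meets_all_orbits S \<tau> \<longleftrightarrow> (\<forall>D. S \<subseteq> D \<longrightarrow> (\<forall>x. x \<in> D \<longleftrightarrow> \<tau> x \<in> D) \<longrightarrow> D = UNIV)"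

text \<open>
  Two arrays agree at the own corner of \<open>x\<close> iff they agree at the other end of the same vertical
  side, because both multiply by the same function; and they agree there iff they agree at
  the own corner of the next element \<open>\<sigma>\<^sup>* x\<close>. At a stationary element the last equivalence holds
  because both values are prescribed.
\<close>

lemma nodal_functions_unique:
  assumes \<sigma>: "bij \<sigma>" and meets: "meets_all_orbits (stationary N \<omega>) (dual_scheme \<sigma>)"
    and \<Phi>: "nodal_functions N \<omega> \<nu> (\<sigma>, F) \<Phi>" and \<Psi>: "nodal_functions N \<omega> \<nu> (\<sigma>, F) \<Psi>"
  shows "\<Phi> = \<Psi>"
proof -
  let ?D = "{x. \<Phi> (own_corner x) = \<Psi> (own_corner x)}"
  have node: "\<And>i. i \<in> {1..N} \<Longrightarrow> \<Theta> (C1, \<omega> i) = psl_scale (\<nu> i)"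
      "\<And>x. \<Theta> (exit_corner x) = (if \<sigma> x \<in> stationary N \<omega> then psl_id else \<Theta> (own_corner (\<sigma> x)))"
      "\<And>\<alpha>. \<Theta> (C4, \<alpha>) = F \<alpha> \<odot> \<Theta> (C1, \<alpha>)" "\<And>\<alpha>. \<Theta> (C3, \<alpha>) = F \<alpha> \<odot> \<Theta> (C2, \<alpha>)"
    if "nodal_functions N \<omega> \<nu> (\<sigma>, F) \<Theta>" for \<Theta>
    using that unfolding nodal_functions_iff[OF \<sigma>] by blast+
  have stat: "stationary N \<omega> \<subseteq> ?D"
    using node(1)[OF \<Phi>] node(1)[OF \<Psi>] by (auto simp: stationary_def)
  have exit: "\<Phi> (exit_corner x) = \<Psi> (exit_corner x) \<longleftrightarrow> \<sigma> x \<in> ?D" for x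
    using node(2)[OF \<Phi>, of x] node(2)[OF \<Psi>, of x] stat by (cases "\<sigma> x \<in> stationary N \<omega>") auto
  have side: "x \<in> ?D \<longleftrightarrow> \<Phi> (exit_corner (flip x)) = \<Psi> (exit_corner (flip x))" for x
    using node(3,4)[OF \<Phi>] node(3,4)[OF \<Psi>]
    by (cases x rule: flip.cases) (auto simp: psl.left_cancel)
  have "?D = UNIV"
    using meets stat exit side unfolding meets_all_orbits_def dual_scheme_def by blast
  then have own: "\<Phi> (own_corner x) = \<Psi> (own_corner x)" for x
    by blast
  then have "\<Phi> (exit_corner x) = \<Psi> (exit_corner x)" for x
    using exit by blast
  note * = own[of "(_, Beg)"] own[of "(_, End)"] this[of "(_, Beg)"] this[of "(_, End)"]
  show ?thesis
  proof
    fix pa show "\<Phi> pa = \<Psi> pa"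
      using * by (cases pa; cases "fst pa") auto
  qed
qed

lemma special_type_meets_dual_orbits:
  assumes "special_type N \<omega> \<sigma>"
  shows "meets_all_orbits (stationary N \<omega>) (dual_scheme \<sigma>)"
  unfolding meets_all_orbits_def
proof (intro allI impI)
  fix D assume D: "stationary N \<omega> \<subseteq> D" "\<forall>x. x \<in> D \<longleftrightarrow> dual_scheme \<sigma> x \<in> D"
  have orbit: "y \<in> D \<longleftrightarrow> x \<in> D" if "y \<in> orbit (dual_scheme \<sigma>) x" for x y
    using that by induction (use D(2) in blast)+
  have "\<exists>y. y \<in> orbit (dual_scheme \<sigma>) x \<and> y \<in> stationary N \<omega>" for x
    using assms unfolding special_type_def cycles_def by blast
  then show "D = UNIV"
    using orbit D(1) by blast
qed

section \<open>Existence of the nodal array\<close>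

definition break_function :: "nat \<Rightarrow> (nat \<Rightarrow> 'a) \<Rightarrow> (nat \<Rightarrow> real) \<Rightarrow> 'a \<Rightarrow> psl" where
  "break_function N \<omega> \<nu> \<alpha> =
     (if \<alpha> \<in> \<omega> ` {1..N} then psl_scale (\<nu> (inv_into {1..N} \<omega> \<alpha>)) else psl_id)"

lemma with_breaks_eq: "with_breaks N \<omega> \<nu> F \<alpha> = F \<alpha> \<odot> break_function N \<omega> \<nu> \<alpha>"
  by (simp add: with_breaks_def break_function_def)

text \<open>
  The walk along \<open>\<sigma>\<^sup>*\<close> goes up the left side of \<open>R\<^sub>\<alpha>\<close> from \<open>(\<alpha>, Beg)\<close> and down its right side from
  \<open>(\<alpha>, End)\<close>. Passing a stationary element from its adjacent corner to its own corner
  multiplies by the break, which the factor from \<open>with_breaks\<close> takes into account.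
\<close>

fun transport :: "nat \<Rightarrow> (nat \<Rightarrow> 'a) \<Rightarrow> (nat \<Rightarrow> real) \<Rightarrow> ('a \<Rightarrow> psl) \<Rightarrow> 'a \<times> side \<Rightarrow> psl" where
  "transport N \<omega> \<nu> F (\<alpha>, Beg) = with_breaks N \<omega> \<nu> F \<alpha>"
| "transport N \<omega> \<nu> F (\<alpha>, End) = psl_inv (F \<alpha>)"

lemma comp_along_snoc: "comp_along F (\<gamma>s @ [\<gamma>]) = F \<gamma> \<odot> comp_along F \<gamma>s"
  by (simp add: comp_along_def)

lemma fold_inv_comp_along:
  "fold (\<lambda>\<delta> H. psl_inv (F \<delta>) \<odot> H) (rev \<delta>s) (comp_along F \<delta>s) = psl_id"
  by (induction \<delta>s rule: rev_induct) (simp_all add: comp_along_snoc, simp add: comp_along_def)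

text \<open>
  The two sides of the commuting relation are the upward and the downward part of the walk
  around a cycle, so the relation says that the holonomy is trivial.
\<close>

lemma fold_transport_cycle:
  assumes "comp_along (with_breaks N \<omega> \<nu> F) \<gamma>s = comp_along F \<delta>s"
  shows "fold (\<lambda>x H. transport N \<omega> \<nu> F x \<odot> H) (cycle_list \<gamma>s \<delta>s) psl_id = psl_id"
proof -
  have "fold (\<lambda>x H. transport N \<omega> \<nu> F x \<odot> H) (cycle_list \<gamma>s \<delta>s) psl_id =
    fold (\<lambda>\<delta> H. psl_inv (F \<delta>) \<odot> H) (rev \<delta>s) (comp_along (with_breaks N \<omega> \<nu> F) \<gamma>s)"
    by (simp add: cycle_list_def fold_map comp_def comp_along_def)
  then show ?thesis
    using assms by (simp add: fold_inv_comp_along)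
qed

text \<open>
  Along a cycle with trivial holonomy the partial products close up. They are the solution
  with value \<open>psl_id\<close> at the head of the list; multiplication from the right by a constant
  moves the normalization to any element \<open>s\<close>.
\<close>

lemma transport_along_list:
  fixes A :: "'b \<Rightarrow> psl"
  assumes c: "distinct c" and closed: "fold (\<lambda>x H. A x \<odot> H) c psl_id = psl_id"
    and \<tau>: "\<And>k. k < length c \<Longrightarrow> \<tau> (c ! k) = c ! (Suc k mod length c)"
    and s: "s \<in> set c"
  shows "\<exists>g. g s = psl_id \<and> (\<forall>x \<in> set c. g (\<tau> x) = A x \<odot> g x)"
proof -
  define P where "P k = fold (\<lambda>x H. A x \<odot> H) (take k c) psl_id" for k
  have P_Suc: "P (Suc k mod length c) = A (c ! k) \<odot> P k" if "k < length c" for k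
  proof -
    have "P (Suc k) = A (c ! k) \<odot> P k"
      using that by (simp add: P_def take_Suc_conv_app_nth)
    moreover have "P (length c) = P 0"
      using closed by (simp add: P_def)
    ultimately show ?thesis
      using that by (cases "Suc k = length c") auto
  qed
  define idx where "idx = the_inv_into {..<length c} ((!) c)"
  have idx: "idx (c ! k) = k" if "k < length c" for k
    unfolding idx_def using c that by (intro the_inv_into_f_f) (auto simp: inj_on_nth)
  have "P (idx (\<tau> x)) = A x \<odot> P (idx x)" if "x \<in> set c" for x
  proof -
    from that obtain k where k: "k < length c" "x = c ! k"
      by (auto simp: in_set_conv_nth)
    then have "Suc k mod length c < length c"
      by (intro mod_less_divisor) linarith
    then show ?thesis
      using k by (simp add: \<tau> idx P_Suc)
  qed
  then show ?thesis
    by (intro exI[of _ "\<lambda>x. P (idx x) \<odot> psl_inv (P (idx s))"]) (simp add: psl.assoc)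
qed

lemma orbit_subset_cycle:
  assumes "has_cycle \<tau> \<gamma>s \<delta>s" "x \<in> set (cycle_list \<gamma>s \<delta>s)"
  shows "orbit \<tau> x \<subseteq> set (cycle_list \<gamma>s \<delta>s)"
proof
  have cyc: "\<forall>k < length (cycle_list \<gamma>s \<delta>s). \<tau> (cycle_list \<gamma>s \<delta>s ! k) =
      cycle_list \<gamma>s \<delta>s ! (Suc k mod length (cycle_list \<gamma>s \<delta>s))"
    using assms(1) unfolding has_cycle_def Let_def by blast
  have step: "\<tau> y \<in> set (cycle_list \<gamma>s \<delta>s)" if "y \<in> set (cycle_list \<gamma>s \<delta>s)" for y
  proof -
    from that obtain k where k: "k < length (cycle_list \<gamma>s \<delta>s)" "y = cycle_list \<gamma>s \<delta>s ! k"
      by (auto simp: in_set_conv_nth)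
    then have "\<tau> y = cycle_list \<gamma>s \<delta>s ! (Suc k mod length (cycle_list \<gamma>s \<delta>s))"
      using cyc by blast
    moreover have "Suc k mod length (cycle_list \<gamma>s \<delta>s) < length (cycle_list \<gamma>s \<delta>s)"
      using k(1) by (intro mod_less_divisor) linarith
    ultimately show ?thesis
      by simp
  qed
  fix y assume "y \<in> orbit \<tau> x"
  then show "y \<in> set (cycle_list \<gamma>s \<delta>s)"
    by induction (use assms(2) step in blast)+
qed

lemma finite_doubled_alphabet: "finite (UNIV :: ('a::finite \<times> side) set)"
proof -
  have "(UNIV :: side set) = {Beg, End}"
    by (auto intro: side.exhaust)
  then have "finite (UNIV :: side set)"
    by (metis finite.emptyI finite.insertI)
  then show ?thesis
    by (simp add: finite_prod)
qed

text \<open>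
  The cycles are disjoint, so solutions on the individual cycles can be glued. Each one is
  normalized at the only stationary element of its cycle; with several of them, the
  normalizations could contradict each other.
\<close>

lemma transport_exists:
  fixes \<sigma> :: "'a::finite scheme"
  assumes inj: "inj_on \<omega> {1..N}" and \<sigma>: "special_type N \<omega> \<sigma>"
    and comm: "commuting_collection N \<omega> \<nu> (\<sigma>, F)"
  obtains G where "\<And>x. G (dual_scheme \<sigma> x) = transport N \<omega> \<nu> F x \<odot> G x"
    and "\<And>x. x \<in> stationary N \<omega> \<Longrightarrow> G x = psl_id"
proof -
  let ?\<tau> = "dual_scheme \<sigma>"
  have ie: "interval_exchange_scheme ?\<tau>"
    using \<sigma> by (auto simp: special_type_def rotational_def)
  have "\<forall>C \<in> cycles ?\<tau>. \<exists>g. \<forall>y \<in> C. g (?\<tau> y) = transport N \<omega> \<nu> F y \<odot> g y \<and>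
           (y \<in> stationary N \<omega> \<longrightarrow> g y = psl_id)"
  proof
    fix C assume C: "C \<in> cycles ?\<tau>"
    then obtain x where x: "C = orbit ?\<tau> x"
      by (auto simp: cycles_def)
    obtain \<gamma>s \<delta>s where c: "has_cycle ?\<tau> \<gamma>s \<delta>s" "x \<in> set (cycle_list \<gamma>s \<delta>s)"
      using ie unfolding interval_exchange_scheme_def by blast
    have sub: "C \<subseteq> set (cycle_list \<gamma>s \<delta>s)"
      using orbit_subset_cycle[OF c] x by simp
    have "\<exists>!s. s \<in> C \<and> s \<in> stationary N \<omega>"
      using \<sigma> C unfolding special_type_def by blast
    then obtain s where s: "s \<in> C" "s \<in> stationary N \<omega>"
      and uniq: "\<And>y. y \<in> C \<Longrightarrow> y \<in> stationary N \<omega> \<Longrightarrow> y = s"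
      by blast
    obtain i where i: "i \<in> {1..N}" "s = (\<omega> i, Beg)"
      using s(2) by (auto simp: stationary_def)
    have "\<omega> i \<in> set \<gamma>s"
      using s(1) sub i(2) by (auto simp: cycle_list_def)
    then have "comp_along (with_breaks N \<omega> \<nu> F) \<gamma>s = comp_along F \<delta>s"
      using comm c(1) i(1) unfolding commuting_collection.simps by blast
    then have "fold (\<lambda>x H. transport N \<omega> \<nu> F x \<odot> H) (cycle_list \<gamma>s \<delta>s) psl_id = psl_id"
      by (rule fold_transport_cycle)
    moreover have "s \<in> set (cycle_list \<gamma>s \<delta>s)"
      using s(1) sub by blast
    ultimately obtain g where "g s = psl_id"
      and "\<forall>y \<in> set (cycle_list \<gamma>s \<delta>s). g (?\<tau> y) = transport N \<omega> \<nu> F y \<odot> g y"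
      using transport_along_list[of "cycle_list \<gamma>s \<delta>s" "transport N \<omega> \<nu> F" ?\<tau> s] c(1)
      unfolding has_cycle_def Let_def by blast
    then show "\<exists>g. \<forall>y \<in> C. g (?\<tau> y) = transport N \<omega> \<nu> F y \<odot> g y \<and>
           (y \<in> stationary N \<omega> \<longrightarrow> g y = psl_id)"
      using sub uniq by (intro exI[of _ g]) auto
  qed
  then obtain g where g: "\<And>C y. C \<in> cycles ?\<tau> \<Longrightarrow> y \<in> C \<Longrightarrow>
      g C (?\<tau> y) = transport N \<omega> \<nu> F y \<odot> g C y \<and> (y \<in> stationary N \<omega> \<longrightarrow> g C y = psl_id)"
    by metis
  have "permutation ?\<tau>"
    using ie finite_subset[OF subset_UNIV finite_doubled_alphabet]
    by (simp add: permutation interval_exchange_scheme_def)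
  then have perm: "y \<in> orbit ?\<tau> y \<and> orbit ?\<tau> (?\<tau> y) = orbit ?\<tau> y" for y
    by (simp add: permutation_self_in_orbit permutation_orbit_step)
  show thesis
  proof (rule that[of "\<lambda>y. g (orbit ?\<tau> y) y"])
    show "g (orbit ?\<tau> (?\<tau> y)) (?\<tau> y) = transport N \<omega> \<nu> F y \<odot> g (orbit ?\<tau> y) y" for y
      using g[of "orbit ?\<tau> y" y] perm[of y] by (simp add: cycles_def)
    show "g (orbit ?\<tau> y) y = psl_id" if "y \<in> stationary N \<omega>" for y
      using g[of "orbit ?\<tau> y" y] perm[of y] that by (simp add: cycles_def)
  qed
qed

text \<open>
  \<open>G x\<close> is the value just before a possible jump at \<open>x\<close>, that is, at the corner adjacent to the
  own corner of \<open>x\<close>; the factor \<open>B\<close> is the jump.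
\<close>

fun array_of_transport :: "'a scheme \<Rightarrow> ('a \<Rightarrow> psl) \<Rightarrow> ('a \<times> side \<Rightarrow> psl) \<Rightarrow> corner \<times> 'a \<Rightarrow> psl" where
  "array_of_transport \<sigma> B G (C1, \<alpha>) = B \<alpha> \<odot> G (\<alpha>, Beg)"
| "array_of_transport \<sigma> B G (C2, \<alpha>) = G (\<sigma> (\<alpha>, Beg))"
| "array_of_transport \<sigma> B G (C3, \<alpha>) = G (\<alpha>, End)"
| "array_of_transport \<sigma> B G (C4, \<alpha>) = G (\<sigma> (\<alpha>, End))"

text \<open>
  The transport equation at \<open>(\<alpha>, Beg)\<close> is the condition on the left side of \<open>R\<^sub>\<alpha>\<close>, and the one at
  \<open>(\<alpha>, End)\<close> is the condition on its right side.
\<close>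

lemma nodal_functions_exist:
  fixes \<sigma> :: "'a::finite scheme"
  assumes inj: "inj_on \<omega> {1..N}" and \<sigma>: "special_type N \<omega> \<sigma>"
    and comm: "commuting_collection N \<omega> \<nu> (\<sigma>, F)"
  obtains \<Phi> where "nodal_functions N \<omega> \<nu> (\<sigma>, F) \<Phi>"
proof -
  obtain G where G: "\<And>x. G (dual_scheme \<sigma> x) = transport N \<omega> \<nu> F x \<odot> G x"
    and stat: "\<And>x. x \<in> stationary N \<omega> \<Longrightarrow> G x = psl_id"
    using transport_exists[OF assms] by blast
  have bij: "bij \<sigma>"
    using \<sigma> by (simp add: special_type_def rotational_def interval_exchange_scheme_def)
  let ?\<Phi> = "array_of_transport \<sigma> (break_function N \<omega> \<nu>) G"
  have exit: "?\<Phi> (exit_corner x) = G (\<sigma> x)" for x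
    by (cases x rule: exit_corner.cases) auto
  have own: "?\<Phi> (own_corner y) = G y" if "y \<notin> stationary N \<omega>" for y
    using that by (cases y rule: own_corner.cases) (auto simp: break_function_def stationary_def)
  have "G (\<sigma> (\<alpha>, End)) = F \<alpha> \<odot> (break_function N \<omega> \<nu> \<alpha> \<odot> G (\<alpha>, Beg))" for \<alpha>
    using G[of "(\<alpha>, Beg)"] by (simp add: dual_scheme_def with_breaks_eq psl.assoc)
  moreover have "G (\<alpha>, End) = F \<alpha> \<odot> G (\<sigma> (\<alpha>, Beg))" for \<alpha>
    using G[of "(\<alpha>, End)"] by (simp add: dual_scheme_def)
  moreover have "?\<Phi> (C1, \<omega> i) = psl_scale (\<nu> i)" if "i \<in> {1..N}" for i
  proof -
    have "G (\<omega> i, Beg) = psl_id"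
      using that by (intro stat) (auto simp: stationary_def)
    then show ?thesis
      using that inj by (simp add: break_function_def)
  qed
  ultimately have "nodal_functions N \<omega> \<nu> (\<sigma>, F) ?\<Phi>"
    unfolding nodal_functions_iff[OF bij] exit using own stat by auto
  then show thesis ..
qed

definition dual_function :: "(corner \<times> 'a \<Rightarrow> psl) \<Rightarrow> 'a \<Rightarrow> psl" where
  "dual_function \<Phi> \<alpha> = psl_transpose (psl_inv (\<Phi> (C1, \<alpha>)) \<odot> \<Phi> (C2, \<alpha>))"

lemma dual_collection_eq:
  assumes "bij \<sigma>" "meets_all_orbits (stationary N \<omega>) (dual_scheme \<sigma>)" "nodal_functions N \<omega> \<nu> (\<sigma>, F) \<Phi>"
  shows "dual_collection N \<omega> \<nu> (\<sigma>, F) =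
(dual_scheme \<sigma>, dual_function \<Phi>)"
proof -
  have "nodal_array N \<omega> \<nu> (\<sigma>, F) = \<Phi>"
    unfolding nodal_array_def using nodal_functions_unique[OF assms(1,2)] assms(3) by blast
  then show ?thesis
    by (simp add: dual_collection_def dual_function_def fun_eq_iff psl_transpose_comp psl_transpose_inv)
qed

section \<open>Elementary steps on schemes\<close>

text \<open>
  This is \<open>f\<close> composed with a 3-cycle. If \<open>f a = b\<close>, it removes \<open>b\<close> from its place
  in the cycle of \<open>f\<close> and inserts it between \<open>c\<close> and \<open>f c\<close>. Every elementary step that
  changes a scheme acts on its dual in this way.
\<close>

definition rotate_values :: "('b \<Rightarrow> 'c) \<Rightarrow> 'b \<Rightarrow> 'b \<Rightarrow> 'b \<Rightarrow> 'b \<Rightarrow> 'c" where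
  "rotate_values f a b c = f(a := f b, b := f c, c := f a)"

lemma bij_rotate_values:
  assumes "bij f" "distinct [a, b, c]"
  shows "bij (rotate_values f a b c)"
proof -
  have "rotate_values f a b c = f \<circ> (Transposition.transpose a b \<circ> Transposition.transpose b c)"
    using assms(2) by (auto simp: fun_eq_iff rotate_values_def Transposition.transpose_def)
  then show ?thesis
    using assms(1) by (simp add: bij_comp)
qed

text \<open>
  Moving \<open>u\<close> does not change the cyclic order of the other elements. Hence an invariant set \<open>D\<close> of
  the new permutation becomes an invariant set of \<open>\<tau>\<close> after its membership at \<open>u\<close> is corrected.
  The correction does not affect \<open>S\<close>, as \<open>u \<notin> S\<close>.
\<close>

lemma meets_all_orbits_rotate_values:
  assumes meets: "meets_all_orbits S \<tau>" and u: "u \<notin> S" and p: "\<tau> p = u"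
    and inj: "inj \<tau>" and dist: "distinct [p, u, v]"
  shows "meets_all_orbits S (rotate_values \<tau> p u v)"
  unfolding meets_all_orbits_def
proof (intro allI impI)
  fix D assume D: "S \<subseteq> D" "\<forall>x. x \<in> D \<longleftrightarrow> rotate_values \<tau> p u v x \<in> D"
  have rel: "p \<in> D \<longleftrightarrow> \<tau> u \<in> D" "u \<in> D \<longleftrightarrow> \<tau> v \<in> D" "v \<in> D \<longleftrightarrow> u \<in> D"
    using D(2)[rule_format, of p] D(2)[rule_format, of u] D(2)[rule_format, of v] dist p
    by (simp_all add: rotate_values_def)
  have rel': "x \<in> D \<longleftrightarrow> \<tau> x \<in> D" if "x \<notin> {p, u, v}" for x
    using D(2)[rule_format, of x] that by (simp add: rotate_values_def)
  have \<tau>u: "\<tau> x = u \<longleftrightarrow> x = p" for x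
    using inj p by (auto dest: injD)
  \<comment> \<open>In \<open>\<tau>\<close> the successor of \<open>u\<close> is \<open>\<tau> u\<close>, so this decides about \<open>u\<close>.\<close>
  let ?E = "{x. if x = u then \<tau> u \<in> D else x \<in> D}"
  have "x \<in> ?E \<longleftrightarrow> \<tau> x \<in> ?E" for x
    using rel rel'[of x] \<tau>u dist p by (cases "x \<in> {p, u, v}") auto
  moreover have "S \<subseteq> ?E"
    using D(1) u by auto
  ultimately have "?E = UNIV"
    using meets unfolding meets_all_orbits_def by blast
  then have D_away: "x \<in> D" if "x \<noteq> u" for x
    using that by (metis (mono_tags, lifting) UNIV_I mem_Collect_eq)
  moreover have "u \<in> D"
    using rel(3) D_away[of v] dist by auto
  ultimately show "D = UNIV"
    by (metis UNIV_eq_I)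
qed

lemma flip_flip [simp]: "flip (flip x) = x"
  by (cases x rule: flip.cases) auto

lemma flip_eq_iff [simp]: "flip x = flip y \<longleftrightarrow> x = y"
  by (metis flip_flip)

lemma flip_eq_Pair [simp]: "flip x = (\<alpha>, Beg) \<longleftrightarrow> x = (\<alpha>, End)" "flip x = (\<alpha>, End) \<longleftrightarrow> x = (\<alpha>, Beg)"
  "(\<alpha>, Beg) = flip x \<longleftrightarrow> (\<alpha>, End) = x" "(\<alpha>, End) = flip x \<longleftrightarrow> (\<alpha>, Beg) = x"
  by (cases x rule: flip.cases; simp)+

lemma dual_scheme_rotate_values:
  "dual_scheme (rotate_values \<sigma> a b c) = rotate_values (dual_scheme \<sigma>) (flip a) (flip b) (flip c)"
proof -
  have "flip x = y \<longleftrightarrow> x = flip y" for x y :: "'a \<times> side"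
    by (metis flip_flip)
  then show ?thesis
    by (auto simp: fun_eq_iff rotate_values_def dual_scheme_def)
qed

lemma bij_dual_scheme: "bij \<sigma> \<Longrightarrow> bij (dual_scheme \<sigma>)"
proof -
  assume "bij \<sigma>"
  moreover have "bij flip"
    by (rule involuntory_imp_bij) (rule flip_flip)
  ultimately show "bij (dual_scheme \<sigma>)"
    using bij_comp[of flip \<sigma>] by (simp add: dual_scheme_def comp_def)
qed

text \<open>
  In the following four lemmas the three places are ordered such that the dual permutation
  maps the flip of the first one to the flip of the second one; the dual of the step
  then moves the flip of the second place. The excluded value of \<open>x\<close> is the case in which the
  step does not change the scheme.
\<close>

lemma step_scheme_RB:
  assumes "inj \<sigma>" "\<alpha> \<noteq> \<beta>" "\<sigma> (\<alpha>, Beg) = (\<beta>, End)" "\<sigma> x = (\<alpha>, End)" "x \<noteq> (\<beta>, End)"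
  shows "step_scheme (RB \<alpha> \<beta>) \<sigma> = rotate_values \<sigma> x (\<alpha>, Beg) (\<beta>, End)"
    and "distinct [x, (\<alpha>, Beg), (\<beta>, End)]"
proof -
  have "inv \<sigma> (\<alpha>, End) = x"
    using assms by (simp add: inv_f_eq)
  moreover have "\<sigma> (\<beta>, End) \<noteq> (\<alpha>, End)"
    using assms by (metis injD)
  moreover show "distinct [x, (\<alpha>, Beg), (\<beta>, End)]"
    using assms by auto
  ultimately show "step_scheme (RB \<alpha> \<beta>) \<sigma> = rotate_values \<sigma> x (\<alpha>, Beg) (\<beta>, End)"
    using assms by (auto simp: rotate_values_def fun_eq_iff)
qed

lemma step_scheme_RE:
  assumes "inj \<sigma>" "\<alpha> \<noteq> \<beta>" "\<sigma> (\<alpha>, Beg) = (\<beta>, End)" "\<sigma> x = (\<alpha>, Beg)" "x \<noteq> (\<beta>, Beg)"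
  shows "step_scheme (RE \<alpha> \<beta>) \<sigma> = rotate_values \<sigma> (\<alpha>, Beg) (\<beta>, Beg) x"
    and "distinct [(\<alpha>, Beg), (\<beta>, Beg), x]"
proof -
  have "inv \<sigma> (\<alpha>, Beg) = x"
    using assms by (simp add: inv_f_eq)
  moreover have "\<sigma> (\<beta>, Beg) \<noteq> (\<alpha>, Beg)"
    using assms by (metis injD)
  moreover show "distinct [(\<alpha>, Beg), (\<beta>, Beg), x]"
    using assms by auto
  ultimately show "step_scheme (RE \<alpha> \<beta>) \<sigma> = rotate_values \<sigma> (\<alpha>, Beg) (\<beta>, Beg) x"
    using assms by (auto simp: rotate_values_def fun_eq_iff)
qed

lemma step_scheme_LB:
  assumes "inj \<sigma>" "\<alpha> \<noteq> \<beta>" "\<sigma> (\<beta>, End) = (\<alpha>, Beg)" "\<sigma> x = (\<beta>, End)" "x \<noteq> (\<alpha>, End)"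
  shows "step_scheme (LB \<alpha> \<beta>) \<sigma> = rotate_values \<sigma> (\<beta>, End) (\<alpha>, End) x"
    and "distinct [(\<beta>, End), (\<alpha>, End), x]"
proof -
  have "inv \<sigma> (\<beta>, End) = x"
    using assms by (simp add: inv_f_eq)
  moreover have "\<sigma> (\<alpha>, End) \<noteq> (\<beta>, End)"
    using assms by (metis injD)
  moreover show "distinct [(\<beta>, End), (\<alpha>, End), x]"
    using assms by auto
  ultimately show "step_scheme (LB \<alpha> \<beta>) \<sigma> = rotate_values \<sigma> (\<beta>, End) (\<alpha>, End) x"
    using assms by (auto simp: rotate_values_def fun_eq_iff)
qed

lemma step_scheme_LE:
  assumes "inj \<sigma>" "\<alpha> \<noteq> \<beta>" "\<sigma> (\<beta>, End) = (\<alpha>, Beg)" "\<sigma> x = (\<beta>, Beg)" "x \<noteq> (\<alpha>, Beg)"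
  shows "step_scheme (LE \<alpha> \<beta>) \<sigma> = rotate_values \<sigma> x (\<beta>, End) (\<alpha>, Beg)"
    and "distinct [x, (\<beta>, End), (\<alpha>, Beg)]"
proof -
  have "inv \<sigma> (\<beta>, Beg) = x"
    using assms by (simp add: inv_f_eq)
  moreover have "\<sigma> (\<alpha>, Beg) \<noteq> (\<beta>, Beg)"
    using assms by (metis injD)
  moreover show "distinct [x, (\<beta>, End), (\<alpha>, Beg)]"
    using assms by auto
  ultimately show "step_scheme (LE \<alpha> \<beta>) \<sigma> = rotate_values \<sigma> x (\<beta>, End) (\<alpha>, Beg)"
    using assms by (auto simp: rotate_values_def fun_eq_iff)
qed

fun step_symbols_distinct :: "'a step \<Rightarrow> bool" where
  "step_symbols_distinct (RB \<alpha> \<beta>) \<longleftrightarrow> \<alpha> \<noteq> \<beta>"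
| "step_symbols_distinct (RE \<alpha> \<beta>) \<longleftrightarrow> \<alpha> \<noteq> \<beta>"
| "step_symbols_distinct (LB \<alpha> \<beta>) \<longleftrightarrow> \<alpha> \<noteq> \<beta>"
| "step_symbols_distinct (LE \<alpha> \<beta>) \<longleftrightarrow> \<alpha> \<noteq> \<beta>"

lemma stationary_iff [simp]:
  "(\<alpha>, End) \<notin> stationary N \<omega>" "(\<alpha>, Beg) \<in> stationary N \<omega> \<longleftrightarrow> \<alpha> \<in> \<omega> ` {1..N}"
  by (auto simp: stationary_def)

text \<open>
  The element \<open>flip b\<close> that a step moves in the dual permutation is \<open>\<alpha>e\<close> for rb, \<open>\<beta>e\<close> for re, \<open>\<alpha>b\<close>
  for lb and \<open>\<beta>b\<close> for le. For the last two, it is nonstationary because the step is not prohibited.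
\<close>

lemma step_scheme_cases:
  assumes \<sigma>: "bij \<sigma>" and def: "step_defined p \<sigma>" and np: "\<not> prohibited N \<omega> p"
    and dist: "step_symbols_distinct p"
  obtains "step_scheme p \<sigma> = \<sigma>"
  | a b c where "step_scheme p \<sigma> = rotate_values \<sigma> a b c" "distinct [a, b, c]"
      "\<sigma> a = flip b" "flip b \<notin> stationary N \<omega>"
proof -
  have inj: "inj \<sigma>"
    using \<sigma> by (rule bij_is_inj)
  have surj: "\<exists>x. \<sigma> x = y" for y
    using surj_f_inv_f[OF bij_is_surj[OF \<sigma>]] by blast
  show thesis
  proof (cases p)
    case (RB \<alpha> \<beta>)
    obtain x where x: "\<sigma> x = (\<alpha>, End)" using surj by blast
    show ?thesis
    proof (cases "x = (\<beta>, End)")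
      case True
      then show ?thesis using that(1) x RB by simp
    next
      case False
      have "\<alpha> \<noteq> \<beta>" "\<sigma> (\<alpha>, Beg) = (\<beta>, End)"
        using dist def RB by auto
      note step = step_scheme_RB[OF inj this x False]
      show ?thesis
        using that(2)[of x "(\<alpha>, Beg)" "(\<beta>, End)"] step x \<open>\<sigma> (\<alpha>, Beg) = (\<beta>, End)\<close> RB by auto
    qed
  next
    case (RE \<alpha> \<beta>)
    obtain x where x: "\<sigma> x = (\<alpha>, Beg)" using surj by blast
    show ?thesis
    proof (cases "x = (\<beta>, Beg)")
      case True
      then show ?thesis using that(1) x RE by simp
    next
      case False
      have "\<alpha> \<noteq> \<beta>" "\<sigma> (\<alpha>, Beg) = (\<beta>, End)"
        using dist def RE by auto
      note step = step_scheme_RE[OF inj this x False]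
      show ?thesis
        using that(2)[of "(\<alpha>, Beg)" "(\<beta>, Beg)" x] step x \<open>\<sigma> (\<alpha>, Beg) = (\<beta>, End)\<close> RE by auto
    qed
  next
    case (LB \<alpha> \<beta>)
    obtain x where x: "\<sigma> x = (\<beta>, End)" using surj by blast
    show ?thesis
    proof (cases "x = (\<alpha>, End)")
      case True
      then show ?thesis using that(1) x LB by simp
    next
      case False
      have "\<alpha> \<noteq> \<beta>" "\<sigma> (\<beta>, End) = (\<alpha>, Beg)"
        using dist def LB by auto
      note step = step_scheme_LB[OF inj this x False]
      show ?thesis
        using that(2)[of "(\<beta>, End)" "(\<alpha>, End)" x] step x \<open>\<sigma> (\<beta>, End) = (\<alpha>, Beg)\<close> np LB by auto
    qed
  next
    case (LE \<alpha> \<beta>)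
    obtain x where x: "\<sigma> x = (\<beta>, Beg)" using surj by blast
    show ?thesis
    proof (cases "x = (\<alpha>, Beg)")
      case True
      then show ?thesis using that(1) x LE by simp
    next
      case False
      have "\<alpha> \<noteq> \<beta>" "\<sigma> (\<beta>, End) = (\<alpha>, Beg)"
        using dist def LE by auto
      note step = step_scheme_LE[OF inj this x False]
      show ?thesis
        using that(2)[of x "(\<beta>, End)" "(\<alpha>, Beg)"] step x \<open>\<sigma> (\<beta>, End) = (\<alpha>, Beg)\<close> np LE by auto
    qed
  qed
qed

lemma step_scheme_bij_meets_dual_orbits:
  assumes \<sigma>: "bij \<sigma>" and meets: "meets_all_orbits (stationary N \<omega>) (dual_scheme \<sigma>)"
    and p: "step_defined p \<sigma>" "\<not> prohibited N \<omega> p" "step_symbols_distinct p"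
  shows "bij (step_scheme p \<sigma>)"
    and "meets_all_orbits (stationary N \<omega>) (dual_scheme (step_scheme p \<sigma>))"
proof -
  have "bij (step_scheme p \<sigma>) \<and> meets_all_orbits (stationary N \<omega>) (dual_scheme (step_scheme p \<sigma>))"
    using \<sigma> p
  proof (cases rule: step_scheme_cases)
    case 1
    with \<sigma> meets show ?thesis by simp
  next
    case (2 a b c)
    have "dual_scheme \<sigma> (flip a) = flip b"
      using 2 by (simp add: dual_scheme_def)
    then show ?thesis
      using 2 \<sigma> meets by (auto simp: dual_scheme_rotate_values bij_rotate_values
          intro!: meets_all_orbits_rotate_values bij_is_inj bij_dual_scheme)
  qed
  then show "bij (step_scheme p \<sigma>)"
    "meets_all_orbits (stationary N \<omega>) (dual_scheme (step_scheme p \<sigma>))" by auto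
qed

inductive dual_steps :: "'a step \<Rightarrow> 'a step \<Rightarrow> bool" where
  RB: "\<alpha> \<noteq> \<beta> \<Longrightarrow> dual_steps (RB \<alpha> \<beta>) (RB \<beta> \<alpha>)"
| RE: "\<alpha> \<noteq> \<beta> \<Longrightarrow> dual_steps (RE \<alpha> \<beta>) (LB \<alpha> \<beta>)"
| LB: "\<alpha> \<noteq> \<beta> \<Longrightarrow> dual_steps (LB \<alpha> \<beta>) (RE \<alpha> \<beta>)"
| LE: "\<alpha> \<noteq> \<beta> \<Longrightarrow> dual_steps (LE \<alpha> \<beta>) (LE \<beta> \<alpha>)"

text \<open>
  In the dual scheme the step moves one element of a cycle to another place, and the dual step
  moves the same element back.
\<close>

lemma dual_steps_scheme:
  assumes \<sigma>: "bij \<sigma>" and "dual_steps p q" and "step_defined p \<sigma>"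
  shows "step_scheme q (dual_scheme (step_scheme p \<sigma>)) = dual_scheme \<sigma>"
proof -
  have inj: "inj \<sigma>"
    using \<sigma> by (rule bij_is_inj)
  have surj: "\<exists>x. \<sigma> x = y" for y
    using surj_f_inv_f[OF bij_is_surj[OF \<sigma>]] by blast
  have inj': "inj (rotate_values (dual_scheme \<sigma>) a b c)" if "distinct [a, b, c]" for a b c
    using that \<sigma> by (intro bij_is_inj bij_rotate_values bij_dual_scheme)
  note [simp] = dual_scheme_rotate_values
  show ?thesis
    using assms(2,3)
  proof (cases rule: dual_steps.cases)
    case (RB \<alpha> \<beta>)
    obtain x where x: "\<sigma> x = (\<alpha>, End)" using surj by blast
    show ?thesis
    proof (cases "x = (\<beta>, End)")
      case True
      then show ?thesis using RB x assms(3) by (simp add: dual_scheme_def)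
    next
      case False
      let ?\<tau> = "rotate_values (dual_scheme \<sigma>) (flip x) (\<alpha>, End) (\<beta>, Beg)"
      have p: "dual_scheme (step_scheme p \<sigma>) = ?\<tau>"
        and d: "distinct [flip x, (\<alpha>, End), (\<beta>, Beg)]"
        using step_scheme_RB[OF inj _ _ x False] RB assms(3) by simp_all
      have "step_scheme q ?\<tau> = rotate_values ?\<tau> (flip x) (\<beta>, Beg) (\<alpha>, End)"
        using RB step_scheme_RB(1)[OF inj'[OF d], of \<beta> \<alpha> "flip x"] d x assms(3)
        by (auto simp: rotate_values_def dual_scheme_def)
      then show ?thesis
        unfolding p using d by (auto simp: rotate_values_def fun_eq_iff)
    qed
  next
    case (RE \<alpha> \<beta>)
    obtain x where x: "\<sigma> x = (\<alpha>, Beg)" using surj by blast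
    show ?thesis
    proof (cases "x = (\<beta>, Beg)")
      case True
      then show ?thesis using RE x assms(3) by (simp add: dual_scheme_def)
    next
      case False
      let ?\<tau> = "rotate_values (dual_scheme \<sigma>) (\<alpha>, End) (\<beta>, End) (flip x)"
      have p: "dual_scheme (step_scheme p \<sigma>) = ?\<tau>"
        and d: "distinct [(\<alpha>, End), (\<beta>, End), flip x]"
        using step_scheme_RE[OF inj _ _ x False] RE assms(3) by simp_all
      have "step_scheme q ?\<tau> = rotate_values ?\<tau> (\<beta>, End) (\<alpha>, End) (flip x)"
        using RE step_scheme_LB(1)[OF inj'[OF d], of \<alpha> \<beta> "flip x"] d x assms(3)
        by (auto simp: rotate_values_def dual_scheme_def)
      then show ?thesis
        unfolding p using d by (auto simp: rotate_values_def fun_eq_iff)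
    qed
  next
    case (LB \<alpha> \<beta>)
    obtain x where x: "\<sigma> x = (\<beta>, End)" using surj by blast
    show ?thesis
    proof (cases "x = (\<alpha>, End)")
      case True
      then show ?thesis using LB x assms(3) by (simp add: dual_scheme_def)
    next
      case False
      let ?\<tau> = "rotate_values (dual_scheme \<sigma>) (\<beta>, Beg) (\<alpha>, Beg) (flip x)"
      have p: "dual_scheme (step_scheme p \<sigma>) = ?\<tau>"
        and d: "distinct [(\<beta>, Beg), (\<alpha>, Beg), flip x]"
        using step_scheme_LB[OF inj _ _ x False] LB assms(3) by simp_all
      have "step_scheme q ?\<tau> = rotate_values ?\<tau> (\<alpha>, Beg) (\<beta>, Beg) (flip x)"
        using LB step_scheme_RE(1)[OF inj'[OF d], of \<alpha> \<beta> "flip x"] d x assms(3)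
        by (auto simp: rotate_values_def dual_scheme_def)
      then show ?thesis
        unfolding p using d by (auto simp: rotate_values_def fun_eq_iff)
    qed
  next
    case (LE \<alpha> \<beta>)
    obtain x where x: "\<sigma> x = (\<beta>, Beg)" using surj by blast
    show ?thesis
    proof (cases "x = (\<alpha>, Beg)")
      case True
      then show ?thesis using LE x assms(3) by (simp add: dual_scheme_def)
    next
      case False
      let ?\<tau> = "rotate_values (dual_scheme \<sigma>) (flip x) (\<beta>, Beg) (\<alpha>, End)"
      have p: "dual_scheme (step_scheme p \<sigma>) = ?\<tau>"
        and d: "distinct [flip x, (\<beta>, Beg), (\<alpha>, End)]"
        using step_scheme_LE[OF inj _ _ x False] LE assms(3) by simp_all
      have "step_scheme q ?\<tau> = rotate_values ?\<tau> (flip x) (\<alpha>, End) (\<beta>, Beg)"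
        using LE step_scheme_LE(1)[OF inj'[OF d], of \<beta> \<alpha> "flip x"] d x assms(3)
        by (auto simp: rotate_values_def dual_scheme_def)
      then show ?thesis
        unfolding p using d by (auto simp: rotate_values_def fun_eq_iff)
    qed
  qed
qed

section \<open>Elementary steps on nodal arrays\<close>

text \<open>
  The corners of the rectangles after a step, expressed by the corners before it. For rb, the
  part of \<open>R\<^sub>\<alpha>\<close> above \<open>R\<^sub>\<beta>\<close> is cut off by a vertical line and stacked on \<open>R\<^sub>\<beta>\<close>: the right side of
  \<open>R\<^sub>\<alpha>\<close> moves to the line through \<open>4\<beta>\<close>, and the top of \<open>R\<^sub>\<beta>\<close> moves to the top of the old \<open>R\<^sub>\<alpha>\<close>. For re,
  the part of \<open>R\<^sub>\<beta>\<close> below \<open>R\<^sub>\<alpha>\<close> is given to \<open>R\<^sub>\<alpha>\<close>. The steps lb and le are similar, with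
  the rectangles aligned on the left.
\<close>

fun step_nodal ::
  "'a step \<Rightarrow> ('a \<Rightarrow> psl) \<Rightarrow> (corner \<times> 'a \<Rightarrow> psl) \<Rightarrow> corner \<times> 'a \<Rightarrow> psl" where
  "step_nodal (RB \<alpha> \<beta>) F \<Phi> =
     \<Phi>((C2, \<alpha>) := \<Phi> (C4, \<beta>), (C3, \<alpha>) := F \<alpha> \<odot> \<Phi> (C4, \<beta>),
       (C4, \<beta>) := F \<alpha> \<odot> \<Phi> (C4, \<beta>), (C3, \<beta>) := \<Phi> (C3, \<alpha>))"
| "step_nodal (RE \<alpha> \<beta>) F \<Phi> =
     \<Phi>((C1, \<alpha>) := psl_inv (F \<beta>) \<odot> \<Phi> (C1, \<alpha>), (C2, \<alpha>) := \<Phi> (C2, \<beta>),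
       (C2, \<beta>) := psl_inv (F \<beta>) \<odot> \<Phi> (C1, \<alpha>), (C3, \<beta>) := \<Phi> (C1, \<alpha>))"
| "step_nodal (LB \<alpha> \<beta>) F \<Phi> =
     \<Phi>((C4, \<beta>) := \<Phi> (C4, \<alpha>), (C3, \<beta>) := F \<alpha> \<odot> \<Phi> (C3, \<beta>),
       (C1, \<alpha>) := \<Phi> (C3, \<beta>), (C4, \<alpha>) := F \<alpha> \<odot> \<Phi> (C3, \<beta>))"
| "step_nodal (LE \<alpha> \<beta>) F \<Phi> =
     \<Phi>((C1, \<alpha>) := \<Phi> (C1, \<beta>), (C2, \<alpha>) := psl_inv (F \<beta>) \<odot> \<Phi> (C2, \<alpha>),
       (C1, \<beta>) := psl_inv (F \<beta>) \<odot> \<Phi> (C2, \<alpha>), (C4, \<beta>) := \<Phi> (C2, \<alpha>))"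

lemma exit_corner_eq_iff [simp]:
  "exit_corner x = (C2, \<alpha>) \<longleftrightarrow> x = (\<alpha>, Beg)" "exit_corner x = (C4, \<alpha>) \<longleftrightarrow> x = (\<alpha>, End)"
  "exit_corner x \<noteq> (C1, \<alpha>)" "exit_corner x \<noteq> (C3, \<alpha>)"
  by (cases x rule: exit_corner.cases; simp)+

lemma own_corner_eq_iff [simp]:
  "own_corner x = (C1, \<alpha>) \<longleftrightarrow> x = (\<alpha>, Beg)" "own_corner x = (C3, \<alpha>) \<longleftrightarrow> x = (\<alpha>, End)"
  "own_corner x \<noteq> (C2, \<alpha>)" "own_corner x \<noteq> (C4, \<alpha>)"
  by (cases x rule: own_corner.cases; simp)+

text \<open>
  Away from the three changed places of \<open>\<sigma>\<close>, adjacency and the functions at the corners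
  concerned are as before; at these places it follows from the conditions on \<open>\<Phi>\<close>. Where a step
  uses that \<open>\<Phi>\<close> takes one value at \<open>1\<alpha>\<close> (re, lb, le) or \<open>1\<beta>\<close> (le) and its adjacent corner, the
  symbol is not among the \<open>\<omega>\<^sub>i\<close> because the step is not prohibited. For rb, only corners of type 3
  are used in this way, and there the array never jumps.
\<close>

lemma nodal_functions_step:
  assumes \<sigma>: "bij \<sigma>" and p: "step_defined p \<sigma>" "\<not> prohibited N \<omega> p" "step_symbols_distinct p"
    and \<sigma>': "bij (step_scheme p \<sigma>)" and \<Phi>: "nodal_functions N \<omega> \<nu> (\<sigma>, F) \<Phi>"
  shows "nodal_functions N \<omega> \<nu> (step_collection p (\<sigma>, F)) (step_nodal p F \<Phi>)"
proof -
  have scale: "\<Phi> (C1, \<omega> i) = psl_scale (\<nu> i)" if "i \<in> {1..N}" for i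
    using \<Phi> that unfolding nodal_functions_iff[OF \<sigma>] by blast
  have exit: "\<Phi> (exit_corner y) = (if \<sigma> y \<in> stationary N \<omega> then psl_id else \<Phi> (own_corner (\<sigma> y)))" for y
    using \<Phi> unfolding nodal_functions_iff[OF \<sigma>] by blast
  have left: "\<Phi> (C4, \<xi>) = F \<xi> \<odot> \<Phi> (C1, \<xi>)" and right: "\<Phi> (C3, \<xi>) = F \<xi> \<odot> \<Phi> (C2, \<xi>)" for \<xi>
    using \<Phi> unfolding nodal_functions_iff[OF \<sigma>] by blast+
  have inj: "inj \<sigma>"
    using \<sigma> by (rule bij_is_inj)
  have surj: "\<exists>x. \<sigma> x = y" for y
    using surj_f_inv_f[OF bij_is_surj[OF \<sigma>]] by blast
  have eq: "\<sigma> y = z \<longleftrightarrow> y = x" if "\<sigma> x = z" for x y z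
    using that inj by (metis injD)
  let ?\<Phi> = "step_nodal p F \<Phi>" and ?\<sigma> = "step_scheme p \<sigma>" and ?F = "step_functions p F"
  have "(\<forall>i \<in> {1..N}. ?\<Phi> (C1, \<omega> i) = psl_scale (\<nu> i)) \<and>
     (\<forall>x. ?\<Phi> (exit_corner x) =
        (if ?\<sigma> x \<in> stationary N \<omega> then psl_id else ?\<Phi> (own_corner (?\<sigma> x)))) \<and>
     (\<forall>\<alpha>. ?\<Phi> (C4, \<alpha>) = ?F \<alpha> \<odot> ?\<Phi> (C1, \<alpha>) \<and> ?\<Phi> (C3, \<alpha>) = ?F \<alpha> \<odot> ?\<Phi> (C2, \<alpha>))"
  proof (cases p)
    case (RB \<alpha> \<beta>)
    have ne: "\<alpha> \<noteq> \<beta>" "\<beta> \<noteq> \<alpha>" and def: "\<sigma> (\<alpha>, Beg) = (\<beta>, End)"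
      using p RB by auto
    have glued: "\<Phi> (C2, \<alpha>) = \<Phi> (C3, \<beta>)"
      using exit[of "(\<alpha>, Beg)"] def by simp
    obtain x where x: "\<sigma> x = (\<alpha>, End)" using surj by blast
    have "?\<Phi> (exit_corner y) =
        (if ?\<sigma> y \<in> stationary N \<omega> then psl_id else ?\<Phi> (own_corner (?\<sigma> y)))" for y
    proof (cases "x = (\<beta>, End)")
      case True
      then show ?thesis
        using exit[of y] exit[of x] x ne def eq[OF x, of y] eq[OF def, of y] RB by auto
    next
      case False
      show ?thesis
        unfolding RB step_scheme_RB(1)[OF inj ne(1) def x False]
        using exit[of y] exit[of x] exit[of "(\<beta>, End)"] x ne def False
          eq[OF x, of y] eq[OF def, of y] eq[OF x, of "(\<beta>, End)"] eq[OF def, of "(\<beta>, End)"]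
        by (auto simp: rotate_values_def)
    qed
    then show ?thesis
      using RB ne scale left right glued by (simp add: psl.assoc)
  next
    case (RE \<alpha> \<beta>)
    have ne: "\<alpha> \<noteq> \<beta>" "\<beta> \<noteq> \<alpha>" and def: "\<sigma> (\<alpha>, Beg) = (\<beta>, End)" and ns: "\<alpha> \<notin> \<omega> ` {1..N}"
      using p RE by auto
    have glued: "\<Phi> (C2, \<alpha>) = \<Phi> (C3, \<beta>)"
      using exit[of "(\<alpha>, Beg)"] def by simp
    obtain x where x: "\<sigma> x = (\<alpha>, Beg)" using surj by blast
    have "?\<Phi> (exit_corner y) =
        (if ?\<sigma> y \<in> stationary N \<omega> then psl_id else ?\<Phi> (own_corner (?\<sigma> y)))" for y
    proof (cases "x = (\<beta>, Beg)")
      case True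
      then show ?thesis
        using exit[of y] exit[of x] x ne ns def eq[OF x, of y] eq[OF def, of y] RE by auto
    next
      case False
      show ?thesis
        unfolding RE step_scheme_RE(1)[OF inj ne(1) def x False]
        using exit[of y] exit[of x] exit[of "(\<beta>, Beg)"] x ne ns def False
          eq[OF x, of y] eq[OF def, of y] eq[OF x, of "(\<beta>, Beg)"] eq[OF def, of "(\<beta>, Beg)"]
        by (auto simp: rotate_values_def)
    qed
    then show ?thesis
      using RE ne ns scale left right glued by (auto simp add: psl.assoc)
  next
    case (LB \<alpha> \<beta>)
    have ne: "\<alpha> \<noteq> \<beta>" "\<beta> \<noteq> \<alpha>" and def: "\<sigma> (\<beta>, End) = (\<alpha>, Beg)" and ns: "\<alpha> \<notin> \<omega> ` {1..N}"
      using p LB by auto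
    have glued: "\<Phi> (C4, \<beta>) = \<Phi> (C1, \<alpha>)"
      using exit[of "(\<beta>, End)"] def ns by simp
    obtain x where x: "\<sigma> x = (\<beta>, End)" using surj by blast
    have "?\<Phi> (exit_corner y) =
        (if ?\<sigma> y \<in> stationary N \<omega> then psl_id else ?\<Phi> (own_corner (?\<sigma> y)))" for y
    proof (cases "x = (\<alpha>, End)")
      case True
      then show ?thesis
        using exit[of y] exit[of x] x ne ns def eq[OF x, of y] eq[OF def, of y] LB by auto
    next
      case False
      show ?thesis
        unfolding LB step_scheme_LB(1)[OF inj ne(1) def x False]
        using exit[of y] exit[of x] exit[of "(\<alpha>, End)"] x ne ns def False
          eq[OF x, of y] eq[OF def, of y] eq[OF x, of "(\<alpha>, End)"] eq[OF def, of "(\<alpha>, End)"]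
        by (auto simp: rotate_values_def)
    qed
    then show ?thesis
      using LB ne ns scale left right glued by (auto simp add: psl.assoc)
  next
    case (LE \<alpha> \<beta>)
    have ne: "\<alpha> \<noteq> \<beta>" "\<beta> \<noteq> \<alpha>" and def: "\<sigma> (\<beta>, End) = (\<alpha>, Beg)"
      and ns: "\<alpha> \<notin> \<omega> ` {1..N}" "\<beta> \<notin> \<omega> ` {1..N}"
      using p LE by auto
    have glued: "\<Phi> (C4, \<beta>) = \<Phi> (C1, \<alpha>)"
      using exit[of "(\<beta>, End)"] def ns by simp
    obtain x where x: "\<sigma> x = (\<beta>, Beg)" using surj by blast
    have "?\<Phi> (exit_corner y) =
        (if ?\<sigma> y \<in> stationary N \<omega> then psl_id else ?\<Phi> (own_corner (?\<sigma> y)))" for y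
    proof (cases "x = (\<alpha>, Beg)")
      case True
      then show ?thesis
        using exit[of y] exit[of x] x ne ns def eq[OF x, of y] eq[OF def, of y] LE by auto
    next
      case False
      show ?thesis
        unfolding LE step_scheme_LE(1)[OF inj ne(1) def x False]
        using exit[of y] exit[of x] exit[of "(\<alpha>, Beg)"] x ne ns def False
          eq[OF x, of y] eq[OF def, of y] eq[OF x, of "(\<alpha>, Beg)"] eq[OF def, of "(\<alpha>, Beg)"]
        by (auto simp: rotate_values_def)
    qed
    then show ?thesis
      using LE ne ns scale left right glued by (auto simp add: psl.assoc)
  qed
  then show ?thesis
    unfolding step_collection.simps nodal_functions_iff[OF \<sigma>'] .
qed

text \<open>
  Let \<open>\<Phi>'\<close> be the new array. For rb the dual step yields
  \<open>(\<Phi>\<^sub>1\<^sub>\<alpha>\<inverse> \<odot> \<Phi>'\<^sub>2\<^sub>\<alpha>) \<odot> (\<Phi>\<^sub>1\<^sub>\<beta>\<inverse> \<odot> \<Phi>\<^sub>2\<^sub>\<beta>)\<close> at \<open>\<alpha>\<close>, before transposition, with \<open>\<Phi>'\<^sub>2\<^sub>\<alpha> = \<Phi>\<^sub>4\<^sub>\<beta> = F\<^sub>\<beta> \<odot> \<Phi>\<^sub>1\<^sub>\<beta>\<close>. This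
  is \<open>\<Phi>\<^sub>1\<^sub>\<alpha>\<inverse> \<odot> \<Phi>\<^sub>3\<^sub>\<beta>\<close>, and \<open>\<Phi>\<^sub>3\<^sub>\<beta> = \<Phi>\<^sub>2\<^sub>\<alpha>\<close> by adjacency. The other cases telescope in the same way. The
  transposition reverses the order of the factors, which is what makes \<open>F\<^sup>*\<close> behave under the
  dual step like \<open>F\<close> under the step.
\<close>

lemma dual_steps_functions:
  assumes \<sigma>: "bij \<sigma>" and "dual_steps p q" and p: "step_defined p \<sigma>" "\<not> prohibited N \<omega> p"
    and \<Phi>: "nodal_functions N \<omega> \<nu> (\<sigma>, F) \<Phi>"
  shows "step_functions q (dual_function (step_nodal p F \<Phi>)) = dual_function \<Phi>"
proof -
  have exit: "\<Phi> (exit_corner y) = \<Phi> (own_corner (\<sigma> y))" if "\<sigma> y \<notin> stationary N \<omega>" for y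
    using \<Phi> that unfolding nodal_functions_iff[OF \<sigma>] by presburger
  have left: "\<Phi> (C4, \<xi>) = F \<xi> \<odot> \<Phi> (C1, \<xi>)" and right: "\<Phi> (C3, \<xi>) = F \<xi> \<odot> \<Phi> (C2, \<xi>)" for \<xi>
    using \<Phi> unfolding nodal_functions_iff[OF \<sigma>] by blast+
  show ?thesis
    using assms(2)
  proof (cases rule: dual_steps.cases)
    case (RB \<alpha> \<beta>)
    have glued: "\<Phi> (C2, \<alpha>) = F \<beta> \<odot> \<Phi> (C2, \<beta>)"
      using exit[of "(\<alpha>, Beg)"] p RB right by simp
    show ?thesis
      using RB glued left right
      by (auto simp: fun_eq_iff dual_function_def psl.assoc psl.inverse_distrib_swap
          simp flip: psl_transpose_comp)
  next
    case (RE \<alpha> \<beta>)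
    have glued: "\<Phi> (C2, \<alpha>) = F \<beta> \<odot> \<Phi> (C2, \<beta>)"
      using exit[of "(\<alpha>, Beg)"] p RE right by simp
    show ?thesis
      using RE glued left right
      by (auto simp: fun_eq_iff dual_function_def psl.assoc psl.inverse_distrib_swap
          simp flip: psl_transpose_comp)
  next
    case (LB \<alpha> \<beta>)
    have glued: "\<Phi> (C1, \<alpha>) = F \<beta> \<odot> \<Phi> (C1, \<beta>)"
      using exit[of "(\<beta>, End)"] p LB left by simp
    show ?thesis
      using LB glued left right
      by (auto simp: fun_eq_iff dual_function_def psl.assoc psl.inverse_distrib_swap
          simp flip: psl_transpose_comp)
  next
    case (LE \<alpha> \<beta>)
    have glued: "\<Phi> (C1, \<alpha>) = F \<beta> \<odot> \<Phi> (C1, \<beta>)"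
      using exit[of "(\<beta>, End)"] p LE left by simp
    show ?thesis
      using LE glued left right
      by (auto simp: fun_eq_iff dual_function_def psl.assoc psl.inverse_distrib_swap
          simp flip: psl_transpose_comp)
  qed
qed

theorem theorem1:
  fixes N :: nat
    and \<omega> :: "nat \<Rightarrow> 'a::finite"
    and \<nu> :: "nat \<Rightarrow> real"
    and \<sigma> :: "'a scheme"
    and F :: "'a \<Rightarrow> psl"
    and \<alpha> \<beta> :: 'a
    and p q :: "'a step"
  assumes "N \<ge> 1"
    and "CARD('a) = 2 * N"
    and "inj_on \<omega> {1..N}"
    and "\<And>i. i \<in> {1..N} \<Longrightarrow> \<nu> i > 0"
    and "special_type N \<omega> \<sigma>"
    and "commuting_collection N \<omega> \<nu> (\<sigma>, F)"
    and "\<alpha> \<noteq> \<beta>"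
    and "(p, q) \<in> {(RB \<alpha> \<beta>, RB \<beta> \<alpha>), (RE \<alpha> \<beta>, LB \<alpha> \<beta>), (LB \<alpha> \<beta>, RE \<alpha> \<beta>), (LE \<alpha> \<beta>, LE \<beta> \<alpha>)}"
    and "allowed N \<omega> p \<sigma>"
    and "allowed N \<omega> q (dual_scheme (step_scheme p \<sigma>))"
  shows "step_collection q (dual_collection N \<omega> \<nu> (step_collection p (\<sigma>, F)))
           = dual_collection N \<omega> \<nu> (\<sigma>, F)"
proof -
  have \<sigma>: "bij \<sigma>"
    using assms(5) by (simp add: special_type_def rotational_def interval_exchange_scheme_def)
  have pq: "dual_steps p q" and distinct: "step_symbols_distinct p"
    using assms(7,8) by (auto intro: dual_steps.intros)
  have p: "step_defined p \<sigma>" "\<not> prohibited N \<omega> p"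
    using assms(9) by (auto simp: allowed_def)
  obtain \<Phi> where \<Phi>: "nodal_functions N \<omega> \<nu> (\<sigma>, F) \<Phi>"
    using nodal_functions_exist[OF assms(3,5,6)] by blast
  have meets: "meets_all_orbits (stationary N \<omega>) (dual_scheme \<sigma>)"
    using assms(5) by (rule special_type_meets_dual_orbits)
  note step = step_scheme_bij_meets_dual_orbits[OF \<sigma> meets p distinct]
  have "dual_collection N \<omega> \<nu> (step_collection p (\<sigma>, F)) =
      (dual_scheme (step_scheme p \<sigma>), dual_function (step_nodal p F \<Phi>))"
    using dual_collection_eq[OF step nodal_functions_step[OF \<sigma> p distinct step(1) \<Phi>, unfolded step_collection.simps]]
    by simp
  then show ?thesis
    using dual_steps_scheme[OF \<sigma> pq p(1)] dual_steps_functions[OF \<sigma> pq p \<Phi>]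
      dual_collection_eq[OF \<sigma> meets \<Phi>] by simp
qed

end
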